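(* Let $A=A_s+A_d\epsilon\in\mathbb{DC}^{m\times n}$. Then the DMPGI of $A$ exists if and only if all nonzero singular values of $A$ are appreciable (i.e. $A$ has no positive infinitesimal singular values). Furthermore, in that case, if $A=U\Sigma V^*$ is an SVD of $A$ with $\Sigma=\mathrm{diag}(\Sigma_r,O_{m-r,n-r})$, $\Sigma_r=\mathrm{diag}(\mu_1,\dots,\mu_r)$ with $\mu_1,\dots,\mu_r$ appreciable, then $$A^D=V\begin{bmatrix}\Sigma_r^{-1}&O\\O&O\end{bmatrix}U^*.$$
   Context: A dual number is $a=a_s+a_d\epsilon$ where $\epsilon\neq0$, $\epsilon^2=0$, and $\epsilon$ commutes with real/complex numbers; it is appreciable if $a_s\neq0$ and infinitesimal otherwise. For appreciable $\mu$, $\mu^{-1}=\mu_s^{-1}-\mu_s^{-2}\mu_d\epsilon$. For a dual complex matrix $A=A_s+A_d\epsilon$, $A^*=A_s^*+A_d^*\epsilon$; unitary means $U^*U=UU^*=I$. Every $A\in\mathbb{DC}^{m\times n}$ has an SVD $A=U\Sigma V^*$ with $U\in\mathbb{DC}^{m\times m},V\in\mathbb{DC}^{n\times n}$ unitary and $\Sigma\in\mathbb{D}^{m\times n}$ diagonal with diagonal entries $\mu_1\ge\dots\ge\mu_r$ positive appreciable dual reals, $\mu_{r+1}\ge\dots\ge\mu_t$ positive infinitesimal dual reals, and zeros, $r\le t\le\min\{m,n\}$; these singular values are unique (order on dual reals: $a>b$ iff $a_s>b_s$, or $a_s=b_s$ and $a_d>b_d$). The dual Moore–Penrose generalized inverse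 (DMPGI) of $A$, denoted $A^D$, is a matrix $X\in\mathbb{DC}^{n\times m}$ satisfying $AXA=A$, $XAX=X$, $(AX)^*=AX$, $(XA)^*=XA$. *)

theory Defs
  imports Complex_Main "Jordan_Normal_Form.Matrix"
begin

text \<open>A dual complex matrix A = A_s + A_d eps is represented by the pair (A_s, A_d)
 of complex matrices of equal dimensions. A dual number a = a_s + a_d eps is the pair (a_s, a_d).\<close>

type_synonym dcmat = "complex mat \<times> complex mat"

definition ctrans :: "complex mat \<Rightarrow> complex mat" where
  "ctrans A = mat (dim_col A) (dim_row A) (\<lambda>(i,j). cnj (A $$ (j,i)))"

definition dcarrier :: "nat \<Rightarrow> nat \<Rightarrow> dcmat set" where
  "dcarrier m n = {(As, Ad). As \<in> carrier_mat m n \<and> Ad \<in> carrier_mat m n}"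

text \<open>Product: (A_s + A_d eps)(B_s + B_d eps) = A_s B_s + (A_s B_d + A_d B_s) eps, since eps^2 = 0.\<close>
definition dmult :: "dcmat \<Rightarrow> dcmat \<Rightarrow> dcmat" (infixl "**\<^sub>d" 70) where
  "dmult A B = (fst A * fst B, fst A * snd B + snd A * fst B)"

definition dstar :: "dcmat \<Rightarrow> dcmat" where
  "dstar A = (ctrans (fst A), ctrans (snd A))"

definition dident :: "nat \<Rightarrow> dcmat" where
  "dident n = (1\<^sub>m n, 0\<^sub>m n n)"

definition dunitary :: "nat \<Rightarrow> dcmat \<Rightarrow> bool" where
  "dunitary n U \<longleftrightarrow> U \<in> dcarrier n n \<and> dstar U **\<^sub>d U = dident n \<and> U **\<^sub>d dstar U = dident n"

definition dentry :: "dcmat \<Rightarrow> nat \<Rightarrow> nat \<Rightarrow> complex \<times> complex" where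
  "dentry A i j = (fst A $$ (i,j), snd A $$ (i,j))"

definition dreal_less :: "real \<times> real \<Rightarrow> real \<times> real \<Rightarrow> bool" where
  "dreal_less a b \<longleftrightarrow> fst a < fst b \<or> (fst a = fst b \<and> snd a < snd b)"

definition dreal_le :: "real \<times> real \<Rightarrow> real \<times> real \<Rightarrow> bool" where
  "dreal_le a b \<longleftrightarrow> dreal_less a b \<or> a = b"

definition appreciable :: "complex \<times> complex \<Rightarrow> bool" where
  "appreciable a \<longleftrightarrow> fst a \<noteq> 0"

definition dual_svd :: "nat \<Rightarrow> nat \<Rightarrow> dcmat \<Rightarrow> dcmat \<Rightarrow> dcmat \<Rightarrow> dcmat \<Rightarrow> bool" where
  "dual_svd m n A U S V \<longleftrightarrow>
     dunitary m U \<and> dunitary n V \<and> S \<in> dcarrier m n \<and>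
     (\<forall>i<m. \<forall>j<n. fst S $$ (i,j) \<in> \<real> \<and> snd S $$ (i,j) \<in> \<real>) \<and>
     (\<forall>i<m. \<forall>j<n. i \<noteq> j \<longrightarrow> dentry S i j = (0,0)) \<and>
     (\<exists>r t. r \<le> t \<and> t \<le> min m n \<and>
        (\<forall>i<r. Re (fst S $$ (i,i)) > 0) \<and>
        (\<forall>i. r \<le> i \<and> i < t \<longrightarrow> fst S $$ (i,i) = 0 \<and> Re (snd S $$ (i,i)) > 0) \<and>
        (\<forall>i. t \<le> i \<and> i < min m n \<longrightarrow> dentry S i i = (0,0)) \<and>
        (\<forall>i j. i \<le> j \<and> j < t \<longrightarrow>
            dreal_le (Re (fst S $$ (j,j)), Re (snd S $$ (j,j)))
                     (Re (fst S $$ (i,i)), Re (snd S $$ (i,i))))) \<and>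
     A = U **\<^sub>d S **\<^sub>d dstar V"

definition is_DMPGI :: "nat \<Rightarrow> nat \<Rightarrow> dcmat \<Rightarrow> dcmat \<Rightarrow> bool" where
  "is_DMPGI m n A X \<longleftrightarrow> X \<in> dcarrier n m \<and>
     A **\<^sub>d X **\<^sub>d A = A \<and> X **\<^sub>d A **\<^sub>d X = X \<and>
     dstar (A **\<^sub>d X) = A **\<^sub>d X \<and> dstar (X **\<^sub>d A) = X **\<^sub>d A"

text \<open>The n x m dual matrix [Sigma_r^{-1} O; O O], using mu^{-1} = mu_s^{-1} - mu_s^{-2} mu_d eps.\<close>
definition sigma_r_pinv :: "nat \<Rightarrow> nat \<Rightarrow> nat \<Rightarrow> dcmat \<Rightarrow> dcmat" where
  "sigma_r_pinv m n r S =
     (mat n m (\<lambda>(i,j). if i = j \<and> i < r then inverse (fst S $$ (i,i)) else 0),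
      mat n m (\<lambda>(i,j). if i = j \<and> i < r
                         then - inverse (fst S $$ (i,i) * fst S $$ (i,i)) * snd S $$ (i,i) else 0))"

end

theory Submission
  imports Defs "Jordan_Normal_Form.Schur_Decomposition" "HOL-Library.Product_Lexorder"
    "HOL-Combinatorics.Permutations"
begin

text \<open>A Moore--Penrose inverse is unique and is transported by unitary equivalence, so with a dual
  SVD at hand everything is decided on a diagonal matrix: there the appreciable entries are
  inverted, while for an infinitesimal entry \<open>\<mu>\<close> the equation \<open>\<Sigma> Y \<Sigma> = \<Sigma>\<close> would force
  \<open>\<mu> = \<mu> y \<mu> = 0\<close>.

  The substance is that a dual SVD exists. First diagonalise \<open>A\<^sub>s\<close> to a real \<open>S\<close>. Multiplying
  \<open>S + B \<epsilon>\<close> by unitaries \<open>1 + P \<epsilon>\<close> and \<open>1 + Q \<epsilon>\<close>, where \<open>P\<close> and \<open>Q\<close> are skew-Hermitian,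
  one reaches \<open>S + B' \<epsilon>\<close> with \<open>S\<^sup>* B'\<close> and \<open>B' S\<^sup>*\<close> Hermitian. Such an \<open>S\<close> and \<open>B'\<close> have a
  common complex SVD with real diagonals, found by splitting off one common pair of singular vectors
  at a time; it also serves for the first step, where \<open>B' = 0\<close>. Phases and a permutation finally
  yield the required signs and order.\<close>

section \<open>Conjugate transposes and traces of complex matrices\<close>

declare index_mult_mat(1) [simp del]

lemma index_mult_mat_sum:
  "i < dim_row A \<Longrightarrow> j < dim_col B \<Longrightarrow> dim_col A = dim_row B \<Longrightarrow>
    (A * B) $$ (i, j) = (\<Sum>k<dim_row B. A $$ (i, k) * B $$ (k, j))"
  by (simp add: index_mult_mat(1) scalar_prod_def atLeast0LessThan)

lemma assoc_mult_mat_dim: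
  fixes A B C :: "'a::semiring_0 mat"
  shows "dim_col A = dim_row B \<Longrightarrow> dim_col B = dim_row C \<Longrightarrow> A * B * C = A * (B * C)"
  by (rule assoc_mult_mat[of A "dim_row A" "dim_row B" B "dim_row C" C "dim_col C"]) auto

lemma mult_add_distrib_mat_dim:
  fixes A B C :: "'a::semiring_0 mat"
  shows "dim_col A = dim_row B \<Longrightarrow> dim_row B = dim_row C \<Longrightarrow> dim_col B = dim_col C \<Longrightarrow>
    A * (B + C) = A * B + A * C"
  by (rule mult_add_distrib_mat[of A "dim_row A" "dim_row B" B "dim_col C" C]) auto

lemma add_mult_distrib_mat_dim:
  fixes A B C :: "'a::semiring_0 mat"
  shows "dim_col A = dim_row C \<Longrightarrow> dim_row A = dim_row B \<Longrightarrow> dim_col A = dim_col B \<Longrightarrow>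
    (A + B) * C = A * C + B * C"
  by (rule add_mult_distrib_mat[of A "dim_row A" "dim_col A" B C "dim_col C"]) auto

lemma mult_smult_assoc_mat_dim:
  fixes A B :: "'a::comm_ring_1 mat"
  shows "dim_col A = dim_row B \<Longrightarrow> c \<cdot>\<^sub>m A * B = c \<cdot>\<^sub>m (A * B)"
  by (rule mult_smult_assoc_mat[of A "dim_row A" "dim_row B" B "dim_col B"]) auto

lemma mult_smult_distrib_dim:
  fixes A B :: "'a::comm_ring_1 mat"
  shows "dim_col A = dim_row B \<Longrightarrow> A * (c \<cdot>\<^sub>m B) = c \<cdot>\<^sub>m (A * B)"
  by (rule mult_smult_distrib[of A "dim_row A" "dim_row B" B "dim_col B"]) auto

lemma smult_smult_mat: "c \<cdot>\<^sub>m (d \<cdot>\<^sub>m A) = (c * d) \<cdot>\<^sub>m A" for A :: "'a::semigroup_mult mat"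
  by (intro eq_matI) (auto simp: mult.assoc)

lemma one_smult_mat: "1 \<cdot>\<^sub>m A = A" for A :: "'a::monoid_mult mat"
  by (intro eq_matI) auto

lemma smult_mat_cancel_left: "c \<noteq> 0 \<Longrightarrow> c \<cdot>\<^sub>m A = c \<cdot>\<^sub>m B \<longleftrightarrow> A = B" for A B :: "'a::field mat"
  by (metis left_inverse one_smult_mat smult_smult_mat)

lemma smult_one_mat_inject:
  fixes c d :: "'a::semiring_1"
  assumes "c \<cdot>\<^sub>m 1\<^sub>m (Suc n) = d \<cdot>\<^sub>m 1\<^sub>m (Suc n)"
  shows "c = d"
  using arg_cong[OF assms, of "\<lambda>A. A $$ (0, 0)"] by simp

lemmas mat_dim_simps = assoc_mult_mat_dim mult_add_distrib_mat_dim add_mult_distrib_mat_dim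
  mult_smult_assoc_mat_dim mult_smult_distrib_dim smult_smult_mat

lemma dim_ctrans [simp]: "dim_row (ctrans A) = dim_col A" "dim_col (ctrans A) = dim_row A"
  by (simp_all add: ctrans_def)

lemma index_ctrans [simp]:
  "i < dim_col A \<Longrightarrow> j < dim_row A \<Longrightarrow> ctrans A $$ (i, j) = cnj (A $$ (j, i))"
  by (simp add: ctrans_def)

lemma ctrans_carrier [simp]: "A \<in> carrier_mat m n \<Longrightarrow> ctrans A \<in> carrier_mat n m"
  by auto

lemma ctrans_ctrans [simp]: "ctrans (ctrans A) = A"
  by (intro eq_matI) auto

lemma ctrans_mult: "dim_col A = dim_row B \<Longrightarrow> ctrans (A * B) = ctrans B * ctrans A"
  by (intro eq_matI) (simp_all add: index_mult_mat_sum mult.commute)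

lemma ctrans_add:
  "dim_row A = dim_row B \<Longrightarrow> dim_col A = dim_col B \<Longrightarrow> ctrans (A + B) = ctrans A + ctrans B"
  by (intro eq_matI) auto

lemma ctrans_smult: "ctrans (c \<cdot>\<^sub>m A) = cnj c \<cdot>\<^sub>m ctrans A"
  by (intro eq_matI) auto

lemma ctrans_one [simp]: "ctrans (1\<^sub>m n) = 1\<^sub>m n"
  by (intro eq_matI) auto

lemma ctrans_zero [simp]: "ctrans (0\<^sub>m m n) = 0\<^sub>m n m"
  by (intro eq_matI) auto

definition mat_trace :: "complex mat \<Rightarrow> complex" where
  "mat_trace A = (\<Sum>i<dim_row A. A $$ (i, i))"

lemma mat_trace_mult_commute:
  assumes "dim_col A = dim_row B" "dim_col B = dim_row A"
  shows "mat_trace (A * B) = mat_trace (B * A)"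
proof -
  have "mat_trace (A * B) = (\<Sum>i<dim_row A. \<Sum>k<dim_row B. A $$ (i, k) * B $$ (k, i))"
    using assms by (simp add: mat_trace_def index_mult_mat_sum)
  also have "\<dots> = (\<Sum>k<dim_row B. \<Sum>i<dim_row A. B $$ (k, i) * A $$ (i, k))"
    by (subst sum.swap) (simp add: mult.commute)
  also have "\<dots> = mat_trace (B * A)"
    using assms by (simp add: mat_trace_def index_mult_mat_sum)
  finally show ?thesis .
qed

lemma mat_trace_similar:
  assumes "similar_mat A B"
  shows "mat_trace A = mat_trace B"
proof -
  obtain n P Q where dims: "P \<in> carrier_mat n n" "Q \<in> carrier_mat n n" "B \<in> carrier_mat n n"
    and QP: "Q * P = 1\<^sub>m n" and A: "A = P * B * Q"
    using similar_matD[OF assms] by auto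
  have "mat_trace A = mat_trace (Q * (P * B))"
    unfolding A using dims by (intro mat_trace_mult_commute) auto
  also have "Q * (P * B) = B"
    using dims QP by (simp flip: assoc_mult_mat)
  finally show ?thesis .
qed

lemma mat_trace_add:
  "A \<in> carrier_mat n n \<Longrightarrow> B \<in> carrier_mat n n \<Longrightarrow> mat_trace (A + B) = mat_trace A + mat_trace B"
  by (simp add: mat_trace_def sum.distrib)

lemma mat_trace_smult: "A \<in> carrier_mat n n \<Longrightarrow> mat_trace (c \<cdot>\<^sub>m A) = c * mat_trace A"
  by (simp add: mat_trace_def sum_distrib_left)

lemma mat_trace_ctrans: "A \<in> carrier_mat n n \<Longrightarrow> mat_trace (ctrans A) = cnj (mat_trace A)"
  by (simp add: mat_trace_def)

definition frobenius_sq :: "complex mat \<Rightarrow> real" where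
  "frobenius_sq A = (\<Sum>j<dim_col A. \<Sum>i<dim_row A. (cmod (A $$ (i, j)))\<^sup>2)"

lemma frobenius_sq_nonneg: "frobenius_sq A \<ge> 0"
  unfolding frobenius_sq_def by (intro sum_nonneg) simp

lemma frobenius_sq_eq_0_iff: "frobenius_sq A = 0 \<longleftrightarrow> A = 0\<^sub>m (dim_row A) (dim_col A)"
proof
  assume "frobenius_sq A = 0"
  then have "\<forall>j<dim_col A. \<forall>i<dim_row A. A $$ (i, j) = 0"
    unfolding frobenius_sq_def by (auto simp: sum_nonneg_eq_0_iff sum_nonneg)
  then show "A = 0\<^sub>m (dim_row A) (dim_col A)" by (intro eq_matI) auto
next
  assume "A = 0\<^sub>m (dim_row A) (dim_col A)"
  then have "A $$ (i, j) = 0" if "i < dim_row A" "j < dim_col A" for i j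
    using that by (metis index_zero_mat(1))
  then show "frobenius_sq A = 0" by (simp add: frobenius_sq_def)
qed

lemma mat_trace_ctrans_mult_self: "mat_trace (ctrans A * A) = frobenius_sq A"
  by (simp add: mat_trace_def frobenius_sq_def index_mult_mat_sum mult.commute
      flip: complex_norm_square)

lemma ctrans_mult_self_column:
  assumes "v \<in> carrier_mat n 1"
  shows "ctrans v * v = complex_of_real (frobenius_sq v) \<cdot>\<^sub>m 1\<^sub>m 1"
proof -
  have "(ctrans v * v) $$ (0, 0) = frobenius_sq v"
    using assms mat_trace_ctrans_mult_self[of v] by (simp add: mat_trace_def)
  then show ?thesis using assms by (intro eq_matI) auto
qed

lemma ctrans_mult_self_eq_0:
  assumes "ctrans A * A = 0\<^sub>m k k"
  shows "A = 0\<^sub>m (dim_row A) (dim_col A)"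
proof -
  have "complex_of_real (frobenius_sq A) = 0"
    using mat_trace_ctrans_mult_self[of A] by (simp add: assms mat_trace_def)
  then show ?thesis by (simp add: frobenius_sq_eq_0_iff)
qed

definition unit_column :: "nat \<Rightarrow> complex mat \<Rightarrow> bool" where
  "unit_column n v \<longleftrightarrow> v \<in> carrier_mat n 1 \<and> ctrans v * v = 1\<^sub>m 1"

lemma unit_columnD:
  assumes "unit_column n v"
  shows "dim_row v = n" "dim_col v = 1" "ctrans v * v = 1\<^sub>m 1" "n > 0"
proof -
  show basic: "dim_row v = n" "dim_col v = 1" "ctrans v * v = 1\<^sub>m 1"
    using assms by (auto simp: unit_column_def)
  have "n \<noteq> 0"
  proof
    assume "n = 0"
    then have "(ctrans v * v) $$ (0, 0) = 0" using basic(1,2) by (simp add: index_mult_mat_sum)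
    then show False by (simp add: basic(3))
  qed
  then show "n > 0" by simp
qed

lemma ex_unit_multiple:
  assumes v: "v \<in> carrier_mat n 1" "v \<noteq> 0\<^sub>m n 1"
  obtains c where "unit_column n (c \<cdot>\<^sub>m v)"
proof
  define s where "s = frobenius_sq v"
  have "s > 0"
    using frobenius_sq_nonneg[of v] frobenius_sq_eq_0_iff[of v] v by (auto simp: s_def)
  then have "(1 / sqrt s) * (1 / sqrt s) * s = 1" by (simp add: field_simps)
  then have "complex_of_real (1 / sqrt s) * complex_of_real (1 / sqrt s) * s = 1"
    by (metis of_real_1 of_real_mult)
  then show "unit_column n (complex_of_real (1 / sqrt s) \<cdot>\<^sub>m v)"
    using v(1) ctrans_mult_self_column[OF v(1)]
    by (simp add: unit_column_def ctrans_smult mat_dim_simps one_smult_mat mult.assoc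
        flip: s_def del: of_real_divide)
qed

section \<open>Unitary matrices\<close>

definition unitary_mat :: "nat \<Rightarrow> complex mat \<Rightarrow> bool" where
  "unitary_mat n U \<longleftrightarrow> U \<in> carrier_mat n n \<and> ctrans U * U = 1\<^sub>m n \<and> U * ctrans U = 1\<^sub>m n"

lemma unitary_matI:
  assumes "U \<in> carrier_mat n n" "ctrans U * U = 1\<^sub>m n"
  shows "unitary_mat n U"
  using assms mat_mult_left_right_inverse[of "ctrans U" n U] by (simp add: unitary_mat_def)

lemma unitary_matD:
  assumes "unitary_mat n U"
  shows "dim_row U = n" "dim_col U = n" "ctrans U * U = 1\<^sub>m n" "U * ctrans U = 1\<^sub>m n"
    "dim_row X = n \<Longrightarrow> ctrans U * (U * X) = X" "dim_row X = n \<Longrightarrow> U * (ctrans U * X) = X"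
proof -
  show basic: "dim_row U = n" "dim_col U = n" "ctrans U * U = 1\<^sub>m n" "U * ctrans U = 1\<^sub>m n"
    using assms by (auto simp: unitary_mat_def)
  show "dim_row X = n \<Longrightarrow> ctrans U * (U * X) = X" "dim_row X = n \<Longrightarrow> U * (ctrans U * X) = X"
    using basic by (simp_all flip: assoc_mult_mat_dim)
qed

lemma unitary_mat_one: "unitary_mat n (1\<^sub>m n)"
  by (simp add: unitary_mat_def)

lemma unitary_mat_ctrans: "unitary_mat n U \<Longrightarrow> unitary_mat n (ctrans U)"
  by (simp add: unitary_mat_def)

lemma unitary_mat_smult:
  assumes "unitary_mat n U" "cmod c = 1"
  shows "unitary_mat n (c \<cdot>\<^sub>m U)"
proof (rule unitary_matI)
  have "cnj c * c = 1" using assms(2) by (simp add: mult.commute flip: complex_norm_square)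
  then show "ctrans (c \<cdot>\<^sub>m U) * (c \<cdot>\<^sub>m U) = 1\<^sub>m n"
    using unitary_matD[OF assms(1)]
    by (simp add: ctrans_smult mat_dim_simps one_smult_mat mult.commute)
qed (use assms(1) in \<open>simp add: unitary_mat_def\<close>)

lemma unitary_mat_householder:
  fixes c s :: real
  assumes w: "w \<in> carrier_mat n 1" "ctrans w * w = complex_of_real s \<cdot>\<^sub>m 1\<^sub>m 1" and cs: "c * s = 2"
  shows "unitary_mat n (1\<^sub>m n + complex_of_real (- c) \<cdot>\<^sub>m (w * ctrans w))" (is "unitary_mat n ?H")
proof (rule unitary_matI)
  let ?W = "w * ctrans w"
  have W: "?W \<in> carrier_mat n n" using w by simp
  have "?W * ?W = w * ((ctrans w * w) * ctrans w)" using w(1) by (simp add: assoc_mult_mat_dim)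
  also have "\<dots> = complex_of_real s \<cdot>\<^sub>m ?W" unfolding w(2) using w(1) by (simp add: mat_dim_simps)
  finally have WW: "?W * ?W = complex_of_real s \<cdot>\<^sub>m ?W" .
  have "ctrans ?H = ?H" using w by (simp add: ctrans_add ctrans_smult ctrans_mult)
  then have "ctrans ?H * ?H = 1\<^sub>m n + complex_of_real (- 2 * c + c * (c * s)) \<cdot>\<^sub>m ?W"
    using WW by (intro eq_matI)
      (simp_all add: mat_dim_simps carrier_matD[OF w(1)], simp add: algebra_simps)
  then show "ctrans ?H * ?H = 1\<^sub>m n"
    using W by (intro eq_matI) (auto simp: cs)
qed (use w in simp)

text \<open>Since \<open>r \<ge> 0\<close>, the vector \<open>w = y - x\<close> has \<open>w\<^sup>* w = 2 (1 + r) \<noteq> 0\<close>, so there is a Householder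
  reflection in \<open>w\<close>.\<close>
lemma ex_householder_mat_mapping:
  fixes r :: real
  assumes x: "unit_column n x" and y: "unit_column n y"
    and xy: "ctrans x * y = complex_of_real (- r) \<cdot>\<^sub>m 1\<^sub>m 1" and r: "r \<ge> 0"
  obtains H where "unitary_mat n H" "H * x = y"
proof
  define w where "w = y + (- 1) \<cdot>\<^sub>m x"
  define c where "c = 1 / (1 + r)"
  define H where "H = 1\<^sub>m n + complex_of_real (- c) \<cdot>\<^sub>m (w * ctrans w)"
  have c: "c * (1 + r) = 1" using r by (simp add: c_def)
  note [simp] = unit_columnD(1-3)[OF x] unit_columnD(1-3)[OF y]
  have [simp]: "dim_row w = n" "dim_col w = 1" by (simp_all add: w_def)
  have yx: "ctrans y * x = complex_of_real (- r) \<cdot>\<^sub>m 1\<^sub>m 1"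
    using arg_cong[OF xy, of ctrans] by (simp add: ctrans_mult ctrans_smult)
  have wx: "ctrans w * x = complex_of_real (- (1 + r)) \<cdot>\<^sub>m 1\<^sub>m 1"
    and wy: "ctrans w * y = complex_of_real (1 + r) \<cdot>\<^sub>m 1\<^sub>m 1"
    unfolding w_def by (intro eq_matI; simp add: ctrans_add ctrans_smult mat_dim_simps xy yx)+
  have "ctrans w * w = ctrans w * y + (- 1) \<cdot>\<^sub>m (ctrans w * x)"
    by (subst (2) w_def) (simp add: mat_dim_simps)
  then have ww: "ctrans w * w = complex_of_real (2 * (1 + r)) \<cdot>\<^sub>m 1\<^sub>m 1"
    unfolding wx wy by (intro eq_matI) auto
  show "unitary_mat n H"
    unfolding H_def
    by (rule unitary_mat_householder[OF _ ww]) (use c in \<open>simp_all add: carrier_matI algebra_simps\<close>)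
  have "H * x = x + complex_of_real (- c) \<cdot>\<^sub>m (w * (ctrans w * x))"
    by (simp add: H_def mat_dim_simps)
  also have "\<dots> = x + complex_of_real (c * (1 + r)) \<cdot>\<^sub>m w"
    unfolding wx by (simp add: mult_smult_distrib_dim smult_smult_mat algebra_simps)
  also have "\<dots> = y" unfolding c by (intro eq_matI) (auto simp: w_def)
  finally show "H * x = y" .
qed

lemma ex_phase_to_nonpositive_real:
  obtains \<alpha> where "cmod \<alpha> = 1" "cnj \<alpha> * z = - complex_of_real (cmod z)"
proof
  define \<alpha> where "\<alpha> = (if z = 0 then 1 else - z / cmod z)"
  show "cmod \<alpha> = 1" by (simp add: \<alpha>_def norm_divide)
  have "cnj z * z = cmod z * cmod z"
    by (simp add: mult.commute flip: complex_norm_square power2_eq_square)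
  then show "cnj \<alpha> * z = - complex_of_real (cmod z)" by (auto simp: \<alpha>_def field_simps)
qed

lemma ex_unitary_mat_mapping_unit_column:
  assumes u: "unit_column n u" and v: "unit_column n v"
  obtains W where "unitary_mat n W" "W * u = v"
proof -
  note [simp] = unit_columnD(1-3)[OF u] unit_columnD(1,2)[OF v]
  define z where "z = (ctrans u * v) $$ (0, 0)"
  obtain \<alpha> where \<alpha>: "cmod \<alpha> = 1" "cnj \<alpha> * z = - complex_of_real (cmod z)"
    by (rule ex_phase_to_nonpositive_real)
  have "cnj \<alpha> * \<alpha> = 1" using \<alpha>(1) by (simp add: mult.commute flip: complex_norm_square)
  then have "unit_column n (\<alpha> \<cdot>\<^sub>m u)"
    by (simp add: unit_column_def carrier_matI ctrans_smult mat_dim_simps one_smult_mat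
        mult.commute)
  moreover have "ctrans u * v = z \<cdot>\<^sub>m 1\<^sub>m 1" by (intro eq_matI) (auto simp: z_def)
  then have "ctrans (\<alpha> \<cdot>\<^sub>m u) * v = complex_of_real (- cmod z) \<cdot>\<^sub>m 1\<^sub>m 1"
    by (simp add: ctrans_smult mult_smult_assoc_mat_dim smult_smult_mat \<alpha>(2))
  ultimately obtain H where H: "unitary_mat n H" "H * (\<alpha> \<cdot>\<^sub>m u) = v"
    by (rule ex_householder_mat_mapping[OF _ v]) auto
  then have "\<alpha> \<cdot>\<^sub>m H * u = v"
    by (simp add: mult_smult_assoc_mat_dim mult_smult_distrib_dim unitary_matD(2))
  with unitary_mat_smult[OF H(1) \<alpha>(1)] show thesis by (rule that)
qed

section \<open>Common eigenvectors and common singular vectors\<close>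

lemma ex_nonzero_eigenvalue_if_mat_trace_nonzero:
  assumes N: "N \<in> carrier_mat n n" and trace: "mat_trace N \<noteq> 0"
  obtains l where "l \<noteq> 0" "eigenvalue N l"
proof -
  obtain es where "char_poly N = (\<Prod>a\<leftarrow>es. [:- a, 1:])" using char_poly_factorized[OF N] by blast
  then obtain T where T: "T \<in> carrier_mat n n" "upper_triangular T" "similar_mat N T"
    using schur_decomposition_exists[OF N] by blast
  have "(\<Sum>i<n. T $$ (i, i)) \<noteq> 0"
    using trace mat_trace_similar[OF T(3)] T(1) by (simp add: mat_trace_def)
  then obtain i where i: "i < n" "T $$ (i, i) \<noteq> 0" by (meson lessThan_iff sum.neutral)
  then have "T $$ (i, i) \<in> set (diag_mat T)" using T(1) by (auto simp: diag_mat_def)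
  moreover have "char_poly N = (\<Prod>a\<leftarrow>diag_mat T. [:- a, 1:])"
    using char_poly_similar[OF T(3)] char_poly_upper_triangular[OF T(1,2)] by simp
  ultimately have "eigenvalue N (T $$ (i, i))"
    unfolding eigenvalue_root_char_poly[OF N] by (auto simp: poly_prod_list prod_list_zero_iff)
  then show thesis using i that by blast
qed

lemma ex_unit_eigencolumn:
  assumes N: "N \<in> carrier_mat n n" and "eigenvalue N l"
  obtains v where "unit_column n v" "N * v = l \<cdot>\<^sub>m v"
proof -
  obtain x where x: "x \<in> carrier_vec n" "x \<noteq> 0\<^sub>v n" "N *\<^sub>v x = l \<cdot>\<^sub>v x"
    using assms unfolding eigenvalue_def eigenvector_def by auto
  define w where "w = mat_of_cols n [x]"
  have w: "w \<in> carrier_mat n 1" by (simp add: w_def carrier_matI)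
  have index_w: "w $$ (i, 0) = x $ i" if "i < n" for i
    using that by (simp add: w_def mat_of_cols_def)
  have "w \<noteq> 0\<^sub>m n 1"
  proof
    assume "w = 0\<^sub>m n 1"
    then have "x $ i = 0" if "i < n" for i using index_w[OF that] that by simp
    then show False using x by auto
  qed
  then obtain c where c: "unit_column n (c \<cdot>\<^sub>m w)" by (rule ex_unit_multiple[OF w])
  have "N * w = l \<cdot>\<^sub>m w"
  proof (rule eq_matI)
    fix i j assume "i < dim_row (l \<cdot>\<^sub>m w)" "j < dim_col (l \<cdot>\<^sub>m w)"
    then have ij: "i < n" "j = 0" using w by auto
    have "(N * w) $$ (i, j) = (N *\<^sub>v x) $ i"
      using ij N x(1) by (simp add: index_mult_mat(1) w_def)
    then show "(N * w) $$ (i, j) = (l \<cdot>\<^sub>m w) $$ (i, j)" using ij w x by (simp add: index_w)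
  qed (use N w in auto)
  then have "N * (c \<cdot>\<^sub>m w) = l \<cdot>\<^sub>m (c \<cdot>\<^sub>m w)"
    using N w by (simp add: mat_dim_simps mult.commute)
  then show thesis by (rule that[OF c])
qed

lemma normal_mat_eigencolumn_ctrans:
  assumes N: "N \<in> carrier_mat n n" and normal: "ctrans N * N = N * ctrans N"
    and v: "v \<in> carrier_mat n 1" and Nv: "N * v = l \<cdot>\<^sub>m v"
  shows "ctrans N * v = cnj l \<cdot>\<^sub>m v"
proof -
  note [simp] = carrier_matD[OF N] carrier_matD[OF v]
  define M where "M = N + (- l) \<cdot>\<^sub>m 1\<^sub>m n"
  have [simp]: "dim_row M = n" "dim_col M = n" by (simp_all add: M_def)
  have ctrans_M: "ctrans M = ctrans N + (- cnj l) \<cdot>\<^sub>m 1\<^sub>m n"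
    by (simp add: M_def ctrans_add ctrans_smult)
  have normal_M: "M * ctrans M = ctrans M * M"
    unfolding ctrans_M unfolding M_def
    by (intro eq_matI; simp add: mat_dim_simps normal; simp add: algebra_simps)
  have Mv: "M * v = 0\<^sub>m n 1"
    by (intro eq_matI) (simp_all add: M_def mat_dim_simps Nv)
  have "ctrans (ctrans M * v) * (ctrans M * v) = ctrans v * (M * ctrans M) * v"
    by (simp add: ctrans_mult assoc_mult_mat_dim)
  also have "\<dots> = 0\<^sub>m 1 1" unfolding normal_M by (simp add: assoc_mult_mat_dim Mv)
  finally have zero: "ctrans M * v = 0\<^sub>m n 1" using ctrans_mult_self_eq_0 by fastforce
  have "ctrans N * v = ctrans M * v + cnj l \<cdot>\<^sub>m v"
    by (intro eq_matI) (simp_all add: ctrans_M mat_dim_simps)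
  then show ?thesis unfolding zero using v by simp
qed

text \<open>Two commuting Hermitian matrices are the Hermitian and skew-Hermitian parts of the normal
  matrix \<open>H + \<i> K\<close>, whose eigenvectors are common to both.\<close>
lemma ex_common_eigencolumn:
  assumes H: "H \<in> carrier_mat n n" "ctrans H = H" and K: "K \<in> carrier_mat n n" "ctrans K = K"
    and commute: "H * K = K * H" and trace: "mat_trace H \<noteq> 0"
  obtains v and a b :: real where "unit_column n v"
    "H * v = complex_of_real a \<cdot>\<^sub>m v" "K * v = complex_of_real b \<cdot>\<^sub>m v" "a \<noteq> 0 \<or> b \<noteq> 0"
proof -
  note [simp] = carrier_matD[OF H(1)] carrier_matD[OF K(1)]
  define N where "N = H + \<i> \<cdot>\<^sub>m K"
  have N: "N \<in> carrier_mat n n" using H K by (simp add: N_def)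
  have ctrans_N: "ctrans N = H + (- \<i>) \<cdot>\<^sub>m K" by (simp add: N_def ctrans_add ctrans_smult H K)
  have normal: "ctrans N * N = N * ctrans N"
    unfolding ctrans_N unfolding N_def
    by (intro eq_matI; simp add: mat_dim_simps commute; simp add: algebra_simps)
  have "Im (mat_trace H) = 0" "Im (mat_trace K) = 0"
    using mat_trace_ctrans[OF H(1)] mat_trace_ctrans[OF K(1)] by (simp_all add: H K complex_eq_iff)
  then have "mat_trace N \<noteq> 0"
    using trace H K
    by (simp add: N_def mat_trace_add[of _ n] mat_trace_smult[of _ n] complex_eq_iff)
  then obtain l where l: "l \<noteq> 0" "eigenvalue N l"
    by (rule ex_nonzero_eigenvalue_if_mat_trace_nonzero[OF N])
  obtain v where v: "unit_column n v" and Nv: "N * v = l \<cdot>\<^sub>m v"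
    by (rule ex_unit_eigencolumn[OF N l(2)])
  have v_carrier: "v \<in> carrier_mat n 1" using v by (simp add: unit_column_def)
  note cNv = normal_mat_eigencolumn_ctrans[OF N normal v_carrier Nv]
  note [simp] = carrier_matD[OF N] carrier_matD[OF v_carrier]
  have HN: "H = (1 / 2) \<cdot>\<^sub>m (N + ctrans N)" and KN: "K = (- \<i> / 2) \<cdot>\<^sub>m (N + (- 1) \<cdot>\<^sub>m ctrans N)"
    unfolding ctrans_N by (intro eq_matI; simp add: N_def)+
  have "H * v = (1 / 2) \<cdot>\<^sub>m (l \<cdot>\<^sub>m v + cnj l \<cdot>\<^sub>m v)"
    by (subst HN) (simp add: mat_dim_simps Nv cNv)
  then have Hv: "H * v = complex_of_real (Re l) \<cdot>\<^sub>m v"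
    by (intro eq_matI) (auto simp: complex_add_cnj simp flip: distrib_right)
  have "K * v = (- \<i> / 2) \<cdot>\<^sub>m (l \<cdot>\<^sub>m v + (- cnj l) \<cdot>\<^sub>m v)"
    by (subst KN) (simp add: mat_dim_simps Nv cNv)
  then have Kv: "K * v = complex_of_real (Im l) \<cdot>\<^sub>m v"
    by (intro eq_matI) (auto simp: complex_diff_cnj mult_ac simp flip: left_diff_distrib)
  show thesis by (rule that[OF v Hv Kv]) (use l(1) in \<open>simp add: complex_eq_iff\<close>)
qed

section \<open>Dual matrices and unitary equivalence\<close>

definition dwf :: "dcmat \<Rightarrow> bool" where
  "dwf A \<longleftrightarrow> dim_row (snd A) = dim_row (fst A) \<and> dim_col (snd A) = dim_col (fst A)"

definition drow :: "dcmat \<Rightarrow> nat" where "drow A = dim_row (fst A)"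

definition dcol :: "dcmat \<Rightarrow> nat" where "dcol A = dim_col (fst A)"

lemmas ddim_defs = dwf_def drow_def dcol_def

lemma dcarrier_iff: "A \<in> dcarrier m n \<longleftrightarrow> dwf A \<and> drow A = m \<and> dcol A = n"
  by (cases A) (auto simp: dcarrier_def ddim_defs)

lemma dcarrierD:
  assumes "A \<in> dcarrier m n"
  shows "dim_row (fst A) = m" "dim_col (fst A) = n" "dim_row (snd A) = m" "dim_col (snd A) = n"
  using assms by (auto simp: dcarrier_def)

lemma ddim_dmult [simp]:
  "dwf A \<Longrightarrow> dwf B \<Longrightarrow> dcol A = drow B \<Longrightarrow> dwf (A **\<^sub>d B)"
  "drow (A **\<^sub>d B) = drow A" "dcol (A **\<^sub>d B) = dcol B"
  by (simp_all add: ddim_defs dmult_def)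

lemma ddim_dstar [simp]: "dwf (dstar A) = dwf A" "drow (dstar A) = dcol A" "dcol (dstar A) = drow A"
  by (auto simp: ddim_defs dstar_def)

lemma ddim_dident [simp]: "dwf (dident n)" "drow (dident n) = n" "dcol (dident n) = n"
  by (simp_all add: ddim_defs dident_def)

lemma dmult_assoc:
  assumes "dwf A" "dwf B" "dwf C" "dcol A = drow B" "dcol B = drow C"
  shows "A **\<^sub>d B **\<^sub>d C = A **\<^sub>d (B **\<^sub>d C)"
  using assms
  by (auto simp: ddim_defs dmult_def mat_dim_simps
      intro!: assoc_add_mat[of _ "drow A" "dcol C"] carrier_matI)

lemma dstar_dmult:
  assumes "dwf A" "dwf B" "dcol A = drow B"
  shows "dstar (A **\<^sub>d B) = dstar B **\<^sub>d dstar A"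
  using assms
  by (auto simp: ddim_defs dmult_def dstar_def ctrans_mult ctrans_add
      intro!: comm_add_mat[of _ "dcol B" "drow A"] carrier_matI)

lemma dstar_dstar [simp]: "dstar (dstar A) = A"
  by (simp add: dstar_def)

lemma dstar_dident [simp]: "dstar (dident n) = dident n"
  by (simp add: dstar_def dident_def)

lemma dident_dmult: "dwf A \<Longrightarrow> drow A = n \<Longrightarrow> dident n **\<^sub>d A = A"
  by (cases A) (auto simp: ddim_defs dmult_def dident_def
      intro!: right_add_zero_mat[of _ n "dcol A"] carrier_matI)

lemma dmult_dident: "dwf A \<Longrightarrow> dcol A = n \<Longrightarrow> A **\<^sub>d dident n = A"
  using dstar_dmult[of "dident n" "dstar A"] by (simp add: dident_dmult)

lemma dunitaryD:
  assumes "dunitary n U"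
  shows "dwf U" "drow U = n" "dcol U = n" "dstar U **\<^sub>d U = dident n" "U **\<^sub>d dstar U = dident n"
    "dwf X \<Longrightarrow> drow X = n \<Longrightarrow> dstar U **\<^sub>d (U **\<^sub>d X) = X"
    "dwf X \<Longrightarrow> drow X = n \<Longrightarrow> U **\<^sub>d (dstar U **\<^sub>d X) = X"
proof -
  show basic: "dwf U" "drow U = n" "dcol U = n"
    "dstar U **\<^sub>d U = dident n" "U **\<^sub>d dstar U = dident n"
    using assms by (auto simp: dunitary_def dcarrier_iff)
  show "dwf X \<Longrightarrow> drow X = n \<Longrightarrow> dstar U **\<^sub>d (U **\<^sub>d X) = X"
    "dwf X \<Longrightarrow> drow X = n \<Longrightarrow> U **\<^sub>d (dstar U **\<^sub>d X) = X"
    using basic by (simp_all add: dident_dmult flip: dmult_assoc)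
qed

lemma dunitary_dident: "dunitary n (dident n)"
  by (simp add: dunitary_def dcarrier_iff dident_dmult)

lemma dunitary_dstar: "dunitary n U \<Longrightarrow> dunitary n (dstar U)"
  by (simp add: dunitary_def dcarrier_iff)

lemma dunitary_dmult:
  assumes "dunitary n U" "dunitary n W"
  shows "dunitary n (U **\<^sub>d W)"
  unfolding dunitary_def dcarrier_iff
  by (simp add: dunitaryD[OF assms(1)] dunitaryD[OF assms(2)] dstar_dmult dmult_assoc)

lemma dunitary_of_unitary_mat:
  assumes "unitary_mat n U"
  shows "dunitary n (U, 0\<^sub>m n n)"
  using unitary_matD(1-4)[OF assms]
  by (auto simp: dunitary_def dmult_def dstar_def dident_def dcarrier_def intro!: carrier_matI)

lemma dunitary_one_plus_skew:
  assumes "P \<in> carrier_mat n n" "P + ctrans P = 0\<^sub>m n n"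
  shows "dunitary n (1\<^sub>m n, P)"
proof -
  have "ctrans P + P = 0\<^sub>m n n" using assms comm_add_mat[of P n n "ctrans P"] by simp
  then show ?thesis
    using assms by (auto simp: dunitary_def dmult_def dstar_def dident_def dcarrier_def)
qed

definition dunitary_equiv :: "nat \<Rightarrow> nat \<Rightarrow> dcmat \<Rightarrow> dcmat \<Rightarrow> bool" where
  "dunitary_equiv m n A B \<longleftrightarrow> A \<in> dcarrier m n \<and> B \<in> dcarrier m n \<and>
    (\<exists>U V. dunitary m U \<and> dunitary n V \<and> A = U **\<^sub>d B **\<^sub>d dstar V)"

lemma dunitary_equivI:
  assumes "dunitary m U" "dunitary n V" "B \<in> dcarrier m n" "A = U **\<^sub>d B **\<^sub>d dstar V"
  shows "dunitary_equiv m n A B"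
proof -
  have "A \<in> dcarrier m n"
    using assms(3) unfolding assms(4)
    by (simp add: dcarrier_iff dunitaryD[OF assms(1)] dunitaryD[OF assms(2)])
  then show ?thesis using assms unfolding dunitary_equiv_def by blast
qed

lemma dunitary_equiv_refl: "A \<in> dcarrier m n \<Longrightarrow> dunitary_equiv m n A A"
  by (rule dunitary_equivI[OF dunitary_dident dunitary_dident])
    (simp_all add: dcarrier_iff dident_dmult dmult_dident)

lemma dunitary_equiv_sym:
  assumes "dunitary_equiv m n A B"
  shows "dunitary_equiv m n B A"
proof -
  obtain U V where U: "dunitary m U" and V: "dunitary n V" and A: "A = U **\<^sub>d B **\<^sub>d dstar V"
    and dims: "A \<in> dcarrier m n" "B \<in> dcarrier m n"
    using assms by (auto simp: dunitary_equiv_def)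
  have "B = dstar U **\<^sub>d A **\<^sub>d dstar (dstar V)"
    unfolding A using dims
    by (simp add: dcarrier_iff dmult_assoc dmult_dident dunitaryD[OF U] dunitaryD[OF V])
  then show ?thesis
    by (rule dunitary_equivI[OF dunitary_dstar[OF U] dunitary_dstar[OF V] dims(1)])
qed

lemma dunitary_equiv_trans:
  assumes "dunitary_equiv m n A B" "dunitary_equiv m n B C"
  shows "dunitary_equiv m n A C"
proof -
  obtain U V U' V' where UV: "dunitary m U" "dunitary n V" "A = U **\<^sub>d B **\<^sub>d dstar V"
    "dunitary m U'" "dunitary n V'" "B = U' **\<^sub>d C **\<^sub>d dstar V'" and C: "C \<in> dcarrier m n"
    using assms by (auto simp: dunitary_equiv_def)
  note unitary_rules = dunitaryD[OF UV(1)] dunitaryD[OF UV(2)]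
    dunitaryD[OF UV(4)] dunitaryD[OF UV(5)]
  have "A = (U **\<^sub>d U') **\<^sub>d C **\<^sub>d dstar (V **\<^sub>d V')"
    using C unfolding UV(3,6) by (simp add: dcarrier_iff dmult_assoc dstar_dmult unitary_rules)
  then show ?thesis
    by (rule dunitary_equivI[OF dunitary_dmult[OF UV(1,4)] dunitary_dmult[OF UV(2,5)] C])
qed

lemma dunitary_equiv_of_unitary_mat:
  assumes U: "unitary_mat m U" and V: "unitary_mat n V" and B: "B \<in> dcarrier m n"
  shows "dunitary_equiv m n (U * fst B * ctrans V, U * snd B * ctrans V) B"
proof (rule dunitary_equivI[OF dunitary_of_unitary_mat[OF U] dunitary_of_unitary_mat[OF V] B])
  have "U * snd B \<in> carrier_mat m n" "U * snd B * ctrans V \<in> carrier_mat m n"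
    by (simp_all add: carrier_matI dcarrierD[OF B] unitary_matD(1,2)[OF U] unitary_matD(1,2)[OF V])
  then show "(U * fst B * ctrans V, U * snd B * ctrans V) =
      (U, 0\<^sub>m m m) **\<^sub>d B **\<^sub>d dstar (V, 0\<^sub>m n n)"
    by (simp add: dmult_def dstar_def dcarrierD[OF B]
        unitary_matD(1,2)[OF U] unitary_matD(1,2)[OF V])
qed

lemma dunitary_equiv_unitary_conj:
  assumes "unitary_mat m U" "unitary_mat n V" "A \<in> dcarrier m n"
  shows "dunitary_equiv m n A (ctrans U * fst A * V, ctrans U * snd A * V)"
  using dunitary_equiv_of_unitary_mat[OF assms(1,2)[THEN unitary_mat_ctrans] assms(3)]
  by (simp add: dunitary_equiv_sym)

lemma dunitary_equiv_skew:
  assumes P: "P \<in> carrier_mat m m" "P + ctrans P = 0\<^sub>m m m"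
    and Q: "Q \<in> carrier_mat n n" "Q + ctrans Q = 0\<^sub>m n n"
    and S: "S \<in> carrier_mat m n" and B': "B' \<in> carrier_mat m n"
    and B: "B = S * ctrans Q + (B' + P * S)"
  shows "dunitary_equiv m n (S, B) (S, B')"
proof (rule dunitary_equivI[OF dunitary_one_plus_skew[OF P] dunitary_one_plus_skew[OF Q]])
  show "(S, B) = (1\<^sub>m m, P) **\<^sub>d (S, B') **\<^sub>d dstar (1\<^sub>m n, Q)"
    using S B' P(1) Q(1) unfolding B by (simp add: dmult_def dstar_def)
qed (use S B' in \<open>simp add: dcarrier_def\<close>)

lemma dunitary_equiv_cong_standard_part:
  assumes AB: "dunitary_equiv m n A B" and A': "A' \<in> dcarrier m n" "fst A' = fst A"
  obtains B' where "dunitary_equiv m n A' B'" "fst B' = fst B"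
proof -
  obtain U V where U: "dunitary m U" and V: "dunitary n V" and B: "B = U **\<^sub>d A **\<^sub>d dstar V"
    using dunitary_equiv_sym[OF AB] by (auto simp: dunitary_equiv_def)
  show thesis
  proof
    show "dunitary_equiv m n A' (U **\<^sub>d A' **\<^sub>d dstar V)"
      by (rule dunitary_equiv_sym, rule dunitary_equivI[OF U V A'(1)]) simp
    show "fst (U **\<^sub>d A' **\<^sub>d dstar V) = fst B" unfolding B by (simp add: dmult_def A'(2))
  qed
qed

section \<open>Rectangular diagonal matrices\<close>

definition rect_diag :: "nat \<Rightarrow> nat \<Rightarrow> (nat \<Rightarrow> complex) \<Rightarrow> complex mat" where
  "rect_diag m n f = mat m n (\<lambda>(i, j). if i = j then f i else 0)"

lemma dim_rect_diag [simp]: "dim_row (rect_diag m n f) = m" "dim_col (rect_diag m n f) = n"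
  by (simp_all add: rect_diag_def)

lemma index_rect_diag:
  "i < m \<Longrightarrow> j < n \<Longrightarrow> rect_diag m n f $$ (i, j) = (if i = j then f i else 0)"
  by (simp add: rect_diag_def)

lemma rect_diag_cong:
  "(\<And>i. i < m \<Longrightarrow> i < n \<Longrightarrow> f i = g i) \<Longrightarrow> rect_diag m n f = rect_diag m n g"
  by (intro eq_matI) (auto simp: rect_diag_def)

lemma ctrans_rect_diag: "ctrans (rect_diag m n f) = rect_diag n m (\<lambda>i. cnj (f i))"
  by (intro eq_matI) (auto simp: rect_diag_def)

lemma index_mult_rect_diag:
  "dim_col X = m \<Longrightarrow> i < dim_row X \<Longrightarrow> j < n \<Longrightarrow>
    (X * rect_diag m n f) $$ (i, j) = (if j < m then X $$ (i, j) * f j else 0)"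
  by (simp add: index_mult_mat_sum rect_diag_def) (simp add: if_distrib cong: if_cong)

lemma index_rect_diag_mult:
  "dim_row X = n \<Longrightarrow> i < m \<Longrightarrow> j < dim_col X \<Longrightarrow>
    (rect_diag m n f * X) $$ (i, j) = (if i < n then f i * X $$ (i, j) else 0)"
  by (simp add: index_mult_mat_sum rect_diag_def) (simp add: if_distrib if_distribR cong: if_cong)

lemma rect_diag_mult_rect_diag:
  "rect_diag m n f * rect_diag n k g = rect_diag m k (\<lambda>i. if i < n then f i * g i else 0)"
  by (intro eq_matI) (auto simp: index_rect_diag_mult index_rect_diag)

lemma rect_diag_add_rect_diag:
  "rect_diag m n f + rect_diag m n g = rect_diag m n (\<lambda>i. f i + g i)"
  by (intro eq_matI) (auto simp: rect_diag_def)

definition ddiag :: "nat \<Rightarrow> nat \<Rightarrow> (nat \<Rightarrow> complex) \<Rightarrow> (nat \<Rightarrow> complex) \<Rightarrow> dcmat" where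
  "ddiag m n f g = (rect_diag m n f, rect_diag m n g)"

abbreviation real_ddiag :: "nat \<Rightarrow> nat \<Rightarrow> (nat \<Rightarrow> real) \<Rightarrow> (nat \<Rightarrow> real) \<Rightarrow> dcmat" where
  "real_ddiag m n f g \<equiv> ddiag m n (\<lambda>i. complex_of_real (f i)) (\<lambda>i. complex_of_real (g i))"

lemma ddiag_dcarrier [simp]: "ddiag m n f g \<in> dcarrier m n"
  by (simp add: ddiag_def dcarrier_iff ddim_defs)

section \<open>Dual matrices whose infinitesimal part is normal to the orbit\<close>

text \<open>The matrices \<open>P S + S Q\<^sup>*\<close> with \<open>P, Q\<close> skew-Hermitian form the tangent space at \<open>S\<close> of the
  orbit of \<open>S\<close> under \<open>(U, V) \<mapsto> U S V\<^sup>*\<close>. Its orthogonal complement for the real inner product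
  \<open>Re (tr (X\<^sup>* Y))\<close> consists of the \<open>B\<close> below.\<close>
definition orbit_normal :: "complex mat \<Rightarrow> complex mat \<Rightarrow> bool" where
  "orbit_normal S B \<longleftrightarrow> ctrans B * S = ctrans S * B \<and> B * ctrans S = S * ctrans B"

lemma orbit_normal_commute: "orbit_normal A B \<Longrightarrow> orbit_normal B A"
  by (auto simp: orbit_normal_def)

lemma orbit_normal_zero: "A \<in> carrier_mat m n \<Longrightarrow> orbit_normal A (0\<^sub>m m n)"
  by (auto simp: orbit_normal_def)

lemma orbit_normal_unitary:
  assumes normal: "orbit_normal A B" and U: "unitary_mat m U" and V: "unitary_mat n V"
    and A: "A \<in> carrier_mat m n" and B: "B \<in> carrier_mat m n"
  shows "orbit_normal (ctrans U * A * V) (ctrans U * B * V)"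
proof -
  note [simp] = unitary_matD[OF U] unitary_matD[OF V] carrier_matD[OF A] carrier_matD[OF B]
  have gram: "ctrans (ctrans U * X * V) * (ctrans U * Y * V) = ctrans V * (ctrans X * Y) * V"
    "(ctrans U * X * V) * ctrans (ctrans U * Y * V) = ctrans U * (X * ctrans Y) * U"
    if "X \<in> carrier_mat m n" "Y \<in> carrier_mat m n" for X Y
    using carrier_matD[OF that(1)] carrier_matD[OF that(2)]
    by (simp_all add: ctrans_mult assoc_mult_mat_dim)
  show ?thesis
    using normal unfolding orbit_normal_def gram[OF A B] gram[OF B A] by simp
qed

lemma orbit_normal_gram_commute:
  assumes normal: "orbit_normal A B" and A: "A \<in> carrier_mat m n" and B: "B \<in> carrier_mat m n"
  shows "(ctrans A * A) * (ctrans A * B) = (ctrans A * B) * (ctrans A * A)"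
proof -
  note [simp] = carrier_matD[OF A] carrier_matD[OF B]
  have AB: "ctrans B * A = ctrans A * B" and BA: "B * ctrans A = A * ctrans B"
    using normal by (auto simp: orbit_normal_def)
  have "(ctrans A * B) * (ctrans A * A) = ctrans A * ((B * ctrans A) * A)"
    by (simp add: assoc_mult_mat_dim)
  also have "\<dots> = ctrans A * (A * (ctrans B * A))" unfolding BA by (simp add: assoc_mult_mat_dim)
  also have "\<dots> = (ctrans A * A) * (ctrans A * B)" unfolding AB by (simp add: assoc_mult_mat_dim)
  finally show ?thesis by simp
qed

text \<open>The singular value \<open>s\<close> may be negative.\<close>
definition singular_pair :: "complex mat \<Rightarrow> real \<Rightarrow> complex mat \<Rightarrow> complex mat \<Rightarrow> bool" where
  "singular_pair A s u v \<longleftrightarrow>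
    A * v = complex_of_real s \<cdot>\<^sub>m u \<and> ctrans A * u = complex_of_real s \<cdot>\<^sub>m v"

lemma ex_left_singular_column:
  assumes A: "A \<in> carrier_mat m n" and B: "B \<in> carrier_mat m n"
    and BA: "B * ctrans A = A * ctrans B" and v: "unit_column n v" and a: "a > 0"
    and AAv: "ctrans A * (A * v) = complex_of_real a \<cdot>\<^sub>m v"
    and BAv: "ctrans B * (A * v) = complex_of_real b \<cdot>\<^sub>m v"
  obtains u where "unit_column m u"
    "singular_pair A (sqrt a) u v" "singular_pair B (b / sqrt a) u v"
proof
  note [simp] = carrier_matD[OF A] carrier_matD[OF B] unit_columnD(1-3)[OF v]
  define s where "s = sqrt a"
  have s: "s > 0" "a = s * s" using a by (simp_all add: s_def)
  define u where "u = complex_of_real (1 / s) \<cdot>\<^sub>m (A * v)"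
  have [simp]: "dim_row u = m" "dim_col u = 1" by (simp_all add: u_def)
  have Av: "A * v = complex_of_real s \<cdot>\<^sub>m u"
    using s by (intro eq_matI) (simp_all add: u_def)
  have "complex_of_real a \<cdot>\<^sub>m (B * v) = (B * ctrans A) * (A * v)"
    by (simp add: assoc_mult_mat_dim AAv mult_smult_distrib_dim)
  also have "\<dots> = complex_of_real b \<cdot>\<^sub>m (A * v)"
    unfolding BA by (simp add: assoc_mult_mat_dim BAv mult_smult_distrib_dim)
  also have "\<dots> = complex_of_real a \<cdot>\<^sub>m (complex_of_real (b / s) \<cdot>\<^sub>m u)"
    using s by (simp add: Av smult_smult_mat mult.commute)
  finally have Bv: "B * v = complex_of_real (b / s) \<cdot>\<^sub>m u"
    using a by (simp add: smult_mat_cancel_left)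
  have Au: "ctrans A * u = complex_of_real s \<cdot>\<^sub>m v"
    using s by (simp add: u_def mult_smult_distrib_dim AAv smult_smult_mat)
  have Bu: "ctrans B * u = complex_of_real (b / s) \<cdot>\<^sub>m v"
    by (simp add: u_def mult_smult_distrib_dim BAv smult_smult_mat)
  have "complex_of_real (s * s) \<cdot>\<^sub>m (ctrans u * u) = ctrans (A * v) * (A * v)"
    by (simp add: Av ctrans_smult mat_dim_simps)
  also have "\<dots> = complex_of_real (s * s) \<cdot>\<^sub>m 1\<^sub>m 1"
    by (simp add: ctrans_mult assoc_mult_mat_dim AAv mult_smult_distrib_dim s(2))
  finally have "ctrans u * u = 1\<^sub>m 1" using s by (simp add: smult_mat_cancel_left)
  then show "unit_column m u" by (simp add: unit_column_def carrier_matI)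
  show "singular_pair A (sqrt a) u v" "singular_pair B (b / sqrt a) u v"
    using Av Bv Au Bu by (simp_all add: singular_pair_def s_def)
qed

lemma frobenius_sq_mult_eigencolumn:
  assumes A: "A \<in> carrier_mat m n" and v: "unit_column n v"
    and AAv: "ctrans A * (A * v) = complex_of_real a \<cdot>\<^sub>m v"
  shows "frobenius_sq (A * v) = a"
proof -
  note [simp] = carrier_matD[OF A] unit_columnD(1-3)[OF v]
  have "complex_of_real (frobenius_sq (A * v)) \<cdot>\<^sub>m 1\<^sub>m 1 = ctrans (A * v) * (A * v)"
    by (rule ctrans_mult_self_column[symmetric, of _ m]) (simp add: carrier_matI)
  also have "\<dots> = complex_of_real a \<cdot>\<^sub>m 1\<^sub>m 1"
    by (simp add: ctrans_mult assoc_mult_mat_dim AAv mult_smult_distrib_dim)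
  finally show ?thesis by (auto dest: smult_one_mat_inject)
qed

text \<open>The eigenvalue of \<open>A\<^sup>* A\<close> is positive: if \<open>A v = 0\<close>, then the eigenvalue of
  \<open>A\<^sup>* B = B\<^sup>* A\<close> vanishes as well.\<close>
lemma ex_common_singular_pair_left:
  assumes A: "A \<in> carrier_mat m n" and B: "B \<in> carrier_mat m n"
    and normal: "orbit_normal A B" and nonzero: "A \<noteq> 0\<^sub>m m n"
  obtains u v a b where "unit_column m u" "unit_column n v"
    "singular_pair A a u v" "singular_pair B b u v"
proof -
  note [simp] = carrier_matD[OF A] carrier_matD[OF B]
  have AB: "ctrans B * A = ctrans A * B" and BA: "B * ctrans A = A * ctrans B"
    using normal by (auto simp: orbit_normal_def)
  define H where "H = ctrans A * A"
  define K where "K = ctrans A * B"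
  have H: "H \<in> carrier_mat n n" "ctrans H = H" and K: "K \<in> carrier_mat n n" "ctrans K = K"
    by (simp_all add: H_def K_def carrier_matI ctrans_mult AB)
  have commute: "H * K = K * H"
    unfolding H_def K_def by (rule orbit_normal_gram_commute[OF normal A B])
  have "mat_trace H \<noteq> 0"
    using nonzero by (simp add: H_def mat_trace_ctrans_mult_self frobenius_sq_eq_0_iff)
  then obtain v a b where v: "unit_column n v" and Hv: "H * v = complex_of_real a \<cdot>\<^sub>m v"
    and Kv: "K * v = complex_of_real b \<cdot>\<^sub>m v" and ab: "a \<noteq> 0 \<or> b \<noteq> 0"
    by (rule ex_common_eigencolumn[OF H K commute])
  note [simp] = unit_columnD(1-3)[OF v]
  have AAv: "ctrans A * (A * v) = complex_of_real a \<cdot>\<^sub>m v"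
    using Hv by (simp add: H_def assoc_mult_mat_dim)
  have BAv: "ctrans B * (A * v) = complex_of_real b \<cdot>\<^sub>m v"
    using Kv by (simp add: K_def assoc_mult_mat_dim flip: AB)
  have norm: "frobenius_sq (A * v) = a" by (rule frobenius_sq_mult_eigencolumn[OF A v AAv])
  have "a \<noteq> 0"
  proof
    assume "a = 0"
    then have "A * v = 0\<^sub>m m 1" using norm by (simp add: frobenius_sq_eq_0_iff)
    then have "ctrans v * (complex_of_real b \<cdot>\<^sub>m v) = 0\<^sub>m 1 1" by (simp flip: BAv)
    also have "\<dots> = 0 \<cdot>\<^sub>m 1\<^sub>m 1" by (intro eq_matI) auto
    finally have "b = 0" by (auto simp: mult_smult_distrib_dim dest: smult_one_mat_inject)
    with \<open>a = 0\<close> ab show False by simp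
  qed
  then have "a > 0" using norm frobenius_sq_nonneg[of "A * v"] by simp
  then show thesis
    using ex_left_singular_column[OF A B BA v _ AAv BAv] that[OF _ v] by blast
qed

lemma ex_common_singular_pair:
  assumes A: "A \<in> carrier_mat m n" and B: "B \<in> carrier_mat m n"
    and normal: "orbit_normal A B" and nonzero: "A \<noteq> 0\<^sub>m m n \<or> B \<noteq> 0\<^sub>m m n"
  obtains u v a b where "unit_column m u" "unit_column n v"
    "singular_pair A a u v" "singular_pair B b u v"
  using nonzero
proof
  assume "A \<noteq> 0\<^sub>m m n"
  then show thesis by (rule ex_common_singular_pair_left[OF A B normal]) (rule that)
next
  assume "B \<noteq> 0\<^sub>m m n"
  then show thesis
    by (rule ex_common_singular_pair_left[OF B A orbit_normal_commute[OF normal]]) (rule that)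
qed

section \<open>Deflation\<close>

definition border :: "complex \<Rightarrow> complex mat \<Rightarrow> complex mat" where
  "border a M = four_block_mat (a \<cdot>\<^sub>m 1\<^sub>m 1) (0\<^sub>m 1 (dim_col M)) (0\<^sub>m (dim_row M) 1) M"

lemma dim_border [simp]:
  "dim_row (border a M) = Suc (dim_row M)" "dim_col (border a M) = Suc (dim_col M)"
  by (simp_all add: border_def)

lemma index_border:
  "i < Suc (dim_row M) \<Longrightarrow> j < Suc (dim_col M) \<Longrightarrow> border a M $$ (i, j) =
    (if i = 0 then if j = 0 then a else 0 else if j = 0 then 0 else M $$ (i - 1, j - 1))"
  by (auto simp: border_def)

lemma border_mult:
  assumes "dim_col M = dim_row N"
  shows "border a M * border b N = border (a * b) (M * N)"
  using assms
  by (intro eq_matI) (auto simp: index_mult_mat_sum index_border sum.lessThan_Suc_shift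
      simp del: sum.lessThan_Suc)

lemma border_add:
  assumes "dim_row M = dim_row N" "dim_col M = dim_col N"
  shows "border a M + border b N = border (a + b) (M + N)"
  using assms by (intro eq_matI) (auto simp: index_border)

lemma border_eq_iff: "border a M = border b N \<longleftrightarrow> a = b \<and> M = N"
proof
  assume eq: "border a M = border b N"
  have dims: "dim_row M = dim_row N" "dim_col M = dim_col N"
    using arg_cong[OF eq, of dim_row] arg_cong[OF eq, of dim_col] by simp_all
  have "M $$ (i, j) = N $$ (i, j)" if "i < dim_row N" "j < dim_col N" for i j
    using arg_cong[OF eq, of "\<lambda>X. X $$ (Suc i, Suc j)"] dims that by (simp add: index_border)
  then show "a = b \<and> M = N"
    using dims arg_cong[OF eq, of "\<lambda>X. X $$ (0, 0)"] by (auto simp: index_border)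
qed simp

lemma ctrans_border: "ctrans (border a M) = border (cnj a) (ctrans M)"
  by (intro eq_matI) (auto simp: index_border)

lemma border_one: "border 1 (1\<^sub>m n) = 1\<^sub>m (Suc n)"
  by (intro eq_matI) (auto simp: index_border)

lemma border_zero: "border 0 (0\<^sub>m m n) = 0\<^sub>m (Suc m) (Suc n)"
  by (intro eq_matI) (auto simp: index_border)

lemma border_rect_diag: "border a (rect_diag m n f) = rect_diag (Suc m) (Suc n) (case_nat a f)"
  by (intro eq_matI) (auto simp: index_border rect_diag_def split: nat.split)

lemma orbit_normal_of_border:
  assumes "orbit_normal (border a A) (border b B)"
    and "dim_row A = dim_row B" "dim_col A = dim_col B"
  shows "orbit_normal A B"
  using assms by (simp add: orbit_normal_def ctrans_border border_mult border_eq_iff)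

definition first_unit :: "nat \<Rightarrow> complex mat" where
  "first_unit n = mat n 1 (\<lambda>(i, j). if i = 0 then 1 else 0)"

lemma dim_first_unit [simp]: "dim_row (first_unit n) = n" "dim_col (first_unit n) = 1"
  by (simp_all add: first_unit_def)

lemma index_mult_first_unit:
  assumes "dim_col X = Suc n" "i < dim_row X"
  shows "(X * first_unit (Suc n)) $$ (i, 0) = X $$ (i, 0)"
  using assms
  by (simp add: index_mult_mat_sum first_unit_def sum.lessThan_Suc_shift del: sum.lessThan_Suc)

lemma unit_column_first_unit: "unit_column (Suc n) (first_unit (Suc n))"
proof -
  have "ctrans (first_unit (Suc n)) * first_unit (Suc n) = 1\<^sub>m 1"
    by (intro eq_matI) (simp_all add: index_mult_first_unit, simp add: first_unit_def)
  then show ?thesis by (simp add: unit_column_def carrier_matI)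
qed

lemma eq_border_if_first_unit:
  assumes X: "X \<in> carrier_mat (Suc m) (Suc n)"
    and col: "X * first_unit (Suc n) = a \<cdot>\<^sub>m first_unit (Suc m)"
    and row: "ctrans X * first_unit (Suc m) = cnj a \<cdot>\<^sub>m first_unit (Suc n)"
  obtains X' where "X' \<in> carrier_mat m n" "X = border a X'"
proof
  note [simp] = carrier_matD[OF X]
  have first_col: "X $$ (i, 0) = (if i = 0 then a else 0)" if "i < Suc m" for i
    using index_mult_first_unit[of X n i] that unfolding col by (auto simp: first_unit_def)
  have "cnj (X $$ (0, j)) = (if j = 0 then cnj a else 0)" if "j < Suc n" for j
    using index_mult_first_unit[of "ctrans X" m j] that unfolding row by (auto simp: first_unit_def)
  then have first_row: "X $$ (0, j) = (if j = 0 then a else 0)" if "j < Suc n" for j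
    using that by (metis complex_cnj_cancel_iff complex_cnj_zero)
  show "X = border a (mat m n (\<lambda>(i, j). X $$ (Suc i, Suc j)))"
    by (intro eq_matI) (auto simp: index_border first_col first_row)
qed simp

lemma singular_pair_deflate:
  assumes X: "X \<in> carrier_mat (Suc m) (Suc n)" and uv: "singular_pair X x u v"
    and U: "unitary_mat (Suc m) U" "U * first_unit (Suc m) = u"
    and V: "unitary_mat (Suc n) V" "V * first_unit (Suc n) = v"
  obtains X' where "X' \<in> carrier_mat m n" "ctrans U * X * V = border (complex_of_real x) X'"
proof (rule eq_border_if_first_unit)
  note [simp] = carrier_matD[OF X] unitary_matD[OF U(1)] unitary_matD[OF V(1)]
  have Xv: "X * v = complex_of_real x \<cdot>\<^sub>m u" and Xu: "ctrans X * u = complex_of_real x \<cdot>\<^sub>m v"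
    using uv by (auto simp: singular_pair_def)
  have Uu: "ctrans U * u = first_unit (Suc m)" and Vv: "ctrans V * v = first_unit (Suc n)"
    unfolding U(2)[symmetric] V(2)[symmetric] by simp_all
  have [simp]: "dim_row u = Suc m" "dim_row v = Suc n"
    unfolding U(2)[symmetric] V(2)[symmetric] by simp_all
  show "ctrans U * X * V \<in> carrier_mat (Suc m) (Suc n)" by (simp add: carrier_matI)
  show "ctrans U * X * V * first_unit (Suc n) = complex_of_real x \<cdot>\<^sub>m first_unit (Suc m)"
    by (simp add: assoc_mult_mat_dim V(2) Xv mult_smult_distrib_dim Uu)
  show "ctrans (ctrans U * X * V) * first_unit (Suc m) =
      cnj (complex_of_real x) \<cdot>\<^sub>m first_unit (Suc n)"
    by (simp add: ctrans_mult assoc_mult_mat_dim U(2) Xu mult_smult_distrib_dim Vv)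
qed

definition dborder :: "complex \<Rightarrow> complex \<Rightarrow> dcmat \<Rightarrow> dcmat" where
  "dborder a b A = (border a (fst A), border b (snd A))"

lemma ddim_dborder [simp]:
  "dwf (dborder a b A) = dwf A" "drow (dborder a b A) = Suc (drow A)"
  "dcol (dborder a b A) = Suc (dcol A)"
  by (simp_all add: ddim_defs dborder_def)

lemma dborder_dmult:
  assumes "dwf A" "dwf B" "dcol A = drow B"
  shows "dborder a a' A **\<^sub>d dborder b b' B = dborder (a * b) (a * b' + a' * b) (A **\<^sub>d B)"
  using assms by (simp add: ddim_defs dborder_def dmult_def border_mult border_add)

lemma dstar_dborder: "dstar (dborder a b A) = dborder (cnj a) (cnj b) (dstar A)"
  by (simp add: dborder_def dstar_def ctrans_border)

lemma dborder_dident: "dborder 1 0 (dident n) = dident (Suc n)"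
  by (simp add: dborder_def dident_def border_one border_zero)

lemma dborder_ddiag:
  "dborder a b (ddiag m n f g) = ddiag (Suc m) (Suc n) (case_nat a f) (case_nat b g)"
  by (simp add: dborder_def ddiag_def border_rect_diag)

lemma dunitary_dborder: "dunitary n U \<Longrightarrow> dunitary (Suc n) (dborder 1 0 U)"
  by (simp add: dunitary_def dcarrier_iff dstar_dborder dborder_dmult dborder_dident)

lemma dunitary_equiv_dborder:
  assumes "dunitary_equiv m n A B"
  shows "dunitary_equiv (Suc m) (Suc n) (dborder a b A) (dborder a b B)"
proof -
  obtain U V where U: "dunitary m U" and V: "dunitary n V" and B: "B \<in> dcarrier m n"
    and A: "A = U **\<^sub>d B **\<^sub>d dstar V"
    using assms by (auto simp: dunitary_equiv_def)
  show ?thesis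
  proof (rule dunitary_equivI[OF dunitary_dborder[OF U] dunitary_dborder[OF V]])
    show "dborder a b A = dborder 1 0 U **\<^sub>d dborder a b B **\<^sub>d dstar (dborder 1 0 V)"
      using B unfolding A
      by (simp add: dcarrier_iff dstar_dborder dborder_dmult dunitaryD[OF U] dunitaryD[OF V])
  qed (use B in \<open>simp add: dcarrier_iff\<close>)
qed

lemma orbit_normal_deflate:
  assumes A: "A \<in> dcarrier (Suc m) n" and normal: "orbit_normal (fst A) (snd A)"
    and nonzero: "fst A \<noteq> 0\<^sub>m (Suc m) n \<or> snd A \<noteq> 0\<^sub>m (Suc m) n"
  obtains a b n' A' where "n = Suc n'" "A' \<in> dcarrier m n'" "orbit_normal (fst A') (snd A')"
    "dunitary_equiv (Suc m) n A (dborder (complex_of_real a) (complex_of_real b) A')"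
proof -
  have carrier: "fst A \<in> carrier_mat (Suc m) n" "snd A \<in> carrier_mat (Suc m) n"
    using A by (auto simp: dcarrier_def)
  obtain u v a b where u: "unit_column (Suc m) u" and v: "unit_column n v"
    and uv: "singular_pair (fst A) a u v" "singular_pair (snd A) b u v"
    by (rule ex_common_singular_pair[OF carrier normal nonzero])
  obtain n' where n: "n = Suc n'" using unit_columnD(4)[OF v] by (cases n) auto
  obtain U where U: "unitary_mat (Suc m) U" "U * first_unit (Suc m) = u"
    by (rule ex_unitary_mat_mapping_unit_column[OF unit_column_first_unit u])
  obtain V where V: "unitary_mat (Suc n') V" "V * first_unit (Suc n') = v"
    by (rule ex_unitary_mat_mapping_unit_column[OF unit_column_first_unit v[unfolded n]])
  obtain As' where As': "As' \<in> carrier_mat m n'"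
    "ctrans U * fst A * V = border (complex_of_real a) As'"
    by (rule singular_pair_deflate[OF carrier(1)[unfolded n] uv(1) U V])
  obtain Ad' where Ad': "Ad' \<in> carrier_mat m n'"
    "ctrans U * snd A * V = border (complex_of_real b) Ad'"
    by (rule singular_pair_deflate[OF carrier(2)[unfolded n] uv(2) U V])
  have "orbit_normal As' Ad'"
    using orbit_normal_unitary[OF normal U(1) V(1) carrier[unfolded n]] As'(1) Ad'(1)
    unfolding As'(2) Ad'(2) by (auto intro: orbit_normal_of_border)
  moreover have
    "dunitary_equiv (Suc m) n A (dborder (complex_of_real a) (complex_of_real b) (As', Ad'))"
    using dunitary_equiv_unitary_conj[OF U(1) V(1)[folded n] A]
    unfolding As'(2) Ad'(2) by (simp add: dborder_def)
  ultimately show thesis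
    using that[OF n, of "(As', Ad')"] As'(1) Ad'(1) by (simp add: dcarrier_def)
qed

lemma ex_dunitary_equiv_real_ddiag_zero:
  "\<exists>f g. dunitary_equiv m n (0\<^sub>m m n, 0\<^sub>m m n) (real_ddiag m n f g)"
proof (intro exI)
  have "real_ddiag m n (\<lambda>_. 0) (\<lambda>_. 0) = (0\<^sub>m m n, 0\<^sub>m m n)"
    by (auto simp: ddiag_def rect_diag_def)
  then show "dunitary_equiv m n (0\<^sub>m m n, 0\<^sub>m m n) (real_ddiag m n (\<lambda>_. 0) (\<lambda>_. 0))"
    by (simp add: dunitary_equiv_refl dcarrier_def)
qed

lemma ex_dunitary_equiv_real_ddiag_if_orbit_normal:
  assumes "A \<in> dcarrier m n" "orbit_normal (fst A) (snd A)"
  shows "\<exists>f g. dunitary_equiv m n A (real_ddiag m n f g)"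
  using assms
proof (induction m arbitrary: n A)
  case 0
  then have "A = (0\<^sub>m 0 n, 0\<^sub>m 0 n)" by (intro prod_eqI eq_matI) (simp_all add: dcarrierD)
  then show ?case using ex_dunitary_equiv_real_ddiag_zero by simp
next
  case (Suc m)
  show ?case
  proof (cases "fst A = 0\<^sub>m (Suc m) n \<and> snd A = 0\<^sub>m (Suc m) n")
    case True
    then have "A = (0\<^sub>m (Suc m) n, 0\<^sub>m (Suc m) n)" by (simp add: prod_eq_iff)
    then show ?thesis using ex_dunitary_equiv_real_ddiag_zero by simp
  next
    case False
    then have nonzero: "fst A \<noteq> 0\<^sub>m (Suc m) n \<or> snd A \<noteq> 0\<^sub>m (Suc m) n" by simp
    obtain a b n' A' where n: "n = Suc n'" and A': "A' \<in> dcarrier m n'"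
      "orbit_normal (fst A') (snd A')"
      and equiv: "dunitary_equiv (Suc m) n A (dborder (complex_of_real a) (complex_of_real b) A')"
      by (rule orbit_normal_deflate[OF Suc.prems nonzero])
    obtain f g where "dunitary_equiv m n' A' (real_ddiag m n' f g)"
      using Suc.IH[OF A'] by blast
    from dunitary_equiv_trans[OF equiv[unfolded n] dunitary_equiv_dborder[OF this]]
    have "dunitary_equiv (Suc m) n A (real_ddiag (Suc m) n (case_nat a f) (case_nat b g))"
      by (simp add: dborder_ddiag n nat.case_distrib[of complex_of_real])
    then show ?thesis by blast
  qed
qed

section \<open>The dual singular value decomposition\<close>

text \<open>The last two equations amount to \<open>(s\<^sub>i + s\<^sub>j) (b\<^sub>i\<^sub>j - cnj b\<^sub>j\<^sub>i) = 0\<close> and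
  \<open>(s\<^sub>i - s\<^sub>j) (b\<^sub>i\<^sub>j + cnj b\<^sub>j\<^sub>i) = 0\<close>, which involve only \<open>p - q\<close> and only \<open>p + q\<close>. Where a
  denominator of the solution vanishes, \<open>z / 0 = 0\<close> keeps \<open>p\<close> and \<open>q\<close> skew-Hermitian.\<close>
lemma ex_skew_hermitian_splitting:
  fixes \<beta> :: "nat \<Rightarrow> nat \<Rightarrow> complex" and s :: "nat \<Rightarrow> real"
  obtains p q b :: "nat \<Rightarrow> nat \<Rightarrow> complex"
  where "\<And>i j. cnj (p j i) = - p i j" "\<And>i j. cnj (q j i) = - q i j"
    "\<And>i j. \<beta> i j = b i j + p i j * s j - s i * q i j"
    "\<And>i j. s i * b i j = s j * cnj (b j i)" "\<And>i j. s j * b i j = s i * cnj (b j i)"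
proof
  define x where "x i j = (\<beta> i j + cnj (\<beta> j i)) / complex_of_real (2 * (s j - s i))" for i j
  define y where "y i j = (\<beta> i j - cnj (\<beta> j i)) / complex_of_real (2 * (s i + s j))" for i j
  define p where "p i j = x i j + y i j" for i j
  define q where "q i j = x i j - y i j" for i j
  define b where "b i j = \<beta> i j - p i j * s j + s i * q i j" for i j
  have "cnj (x j i) = (\<beta> i j + cnj (\<beta> j i)) / - complex_of_real (2 * (s j - s i))" for i j
    by (simp add: x_def add.commute)
  then have x: "cnj (x j i) = - x i j" for i j unfolding x_def minus_divide_right .
  have "cnj (y j i) = - (\<beta> i j - cnj (\<beta> j i)) / complex_of_real (2 * (s i + s j))" for i j
    by (simp add: y_def add.commute)
  then have y: "cnj (y j i) = - y i j" for i j unfolding y_def minus_divide_left .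
  show p: "cnj (p j i) = - p i j" and q: "cnj (q j i) = - q i j" for i j
    by (simp_all add: p_def q_def x y)
  show "\<beta> i j = b i j + p i j * s j - s i * q i j" for i j by (simp add: b_def)
  have cnj_b: "cnj (b j i) = cnj (\<beta> j i) + p i j * s i - s j * q i j" for i j
    by (simp add: b_def p q)
  have "b i j + cnj (b j i) =
      \<beta> i j + cnj (\<beta> j i) - complex_of_real (2 * (s j - s i)) * x i j" for i j
    by (simp add: cnj_b) (simp add: b_def p_def q_def algebra_simps)
  then have plus: "(s i - s j) * (b i j + cnj (b j i)) = 0" for i j
    by (cases "s i = s j") (simp_all add: x_def)
  have "b i j - cnj (b j i) =
      \<beta> i j - cnj (\<beta> j i) - complex_of_real (2 * (s i + s j)) * y i j" for i j
    by (simp add: cnj_b) (simp add: b_def p_def q_def algebra_simps)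
  then have minus: "(s i + s j) * (b i j - cnj (b j i)) = 0" for i j
    by (cases "s i + s j = 0") (simp_all add: y_def flip: of_real_add)
  have "2 * (s i * b i j - s j * cnj (b j i)) = 0" for i j
    using arg_cong2[OF plus[of i j] minus[of i j], of "(+)"] by (simp add: algebra_simps)
  then show "s i * b i j = s j * cnj (b j i)" for i j by simp
  have "2 * (s i * cnj (b j i) - s j * b i j) = 0" for i j
    using arg_cong2[OF plus[of i j] minus[of i j], of "(-)"] by (simp add: algebra_simps)
  then show "s j * b i j = s i * cnj (b j i)" for i j by simp
qed

lemma orbit_normal_rect_diagI:
  fixes s :: "nat \<Rightarrow> real" and b :: "nat \<Rightarrow> nat \<Rightarrow> complex"
  assumes s_out: "\<And>i. \<not> i < m \<or> \<not> i < n \<Longrightarrow> s i = 0"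
    and b: "\<And>i j. s i * b i j = s j * cnj (b j i)" "\<And>i j. s j * b i j = s i * cnj (b j i)"
  shows "orbit_normal (rect_diag m n (\<lambda>i. complex_of_real (s i))) (mat m n (\<lambda>(i, j). b i j))"
    (is "orbit_normal ?S ?B")
proof -
  note products = ctrans_rect_diag index_mult_rect_diag index_rect_diag_mult s_out
  have "(ctrans ?B * ?S) $$ (i, j) = s j * cnj (b j i)" "(ctrans ?S * ?B) $$ (i, j) = s i * b i j"
    if "i < n" "j < n" for i j
    using that by (auto simp: products)
  then have "ctrans ?B * ?S = ctrans ?S * ?B" by (intro eq_matI) (simp_all add: b(1))
  moreover have "(?B * ctrans ?S) $$ (i, j) = s j * b i j"
    "(?S * ctrans ?B) $$ (i, j) = s i * cnj (b j i)" if "i < m" "j < m" for i j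
    using that by (auto simp: products)
  then have "?B * ctrans ?S = ?S * ctrans ?B" by (intro eq_matI) (simp_all add: b(2))
  ultimately show ?thesis by (simp add: orbit_normal_def)
qed

lemma ex_orbit_normal_representative:
  assumes B: "B \<in> carrier_mat m n" and S_eq: "S = rect_diag m n (\<lambda>i. complex_of_real (f i))"
  obtains B' where "orbit_normal S B'" "dunitary_equiv m n (S, B) (S, B')"
proof -
  define s where "s i = (if i < min m n then f i else 0)" for i
  have S: "S = rect_diag m n (\<lambda>i. complex_of_real (s i))"
    unfolding S_eq by (rule rect_diag_cong) (simp add: s_def)
  have s_out: "s i = 0" if "\<not> i < m \<or> \<not> i < n" for i using that by (auto simp: s_def)
  define \<beta> where "\<beta> i j = (if i < m \<and> j < n then B $$ (i, j) else 0)" for i j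
  obtain p q b :: "nat \<Rightarrow> nat \<Rightarrow> complex"
    where p: "\<And>i j. cnj (p j i) = - p i j" and q: "\<And>i j. cnj (q j i) = - q i j"
    and \<beta>: "\<And>i j. \<beta> i j = b i j + p i j * s j - s i * q i j"
    and b: "\<And>i j. s i * b i j = s j * cnj (b j i)" "\<And>i j. s j * b i j = s i * cnj (b j i)"
    by (rule ex_skew_hermitian_splitting[of \<beta> s]) blast
  define P where "P = mat m m (\<lambda>(i, j). p i j)"
  define Q where "Q = mat n n (\<lambda>(i, j). q i j)"
  define B' where "B' = mat m n (\<lambda>(i, j). b i j)"
  have "orbit_normal S B'" unfolding S B'_def by (rule orbit_normal_rect_diagI[OF s_out b])
  moreover have "dunitary_equiv m n (S, B) (S, B')"
  proof (rule dunitary_equiv_skew)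
    show "P + ctrans P = 0\<^sub>m m m" "Q + ctrans Q = 0\<^sub>m n n"
      by (auto intro!: eq_matI simp: P_def Q_def p q)
    have "B $$ (i, j) = b i j + p i j * s j - s i * q i j" if "i < m" "j < n" for i j
      using \<beta>[of i j] that by (simp add: \<beta>_def)
    then show "B = S * ctrans Q + (B' + P * S)"
      using B by (intro eq_matI) (auto simp: S P_def Q_def B'_def index_mult_rect_diag
          index_rect_diag_mult s_out q)
  qed (simp_all add: P_def Q_def B'_def S carrier_matI)
  ultimately show thesis by (rule that)
qed

lemma ex_dunitary_equiv_real_ddiag:
  assumes A: "A \<in> dcarrier m n"
  obtains f g where "dunitary_equiv m n A (real_ddiag m n f g)"
proof -
  have "fst A \<in> carrier_mat m n" using A by (auto simp: dcarrier_def)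
  then have "(fst A, 0\<^sub>m m n) \<in> dcarrier m n" "orbit_normal (fst A) (0\<^sub>m m n)"
    by (simp_all add: dcarrier_def orbit_normal_zero)
  then obtain s t where "dunitary_equiv m n (fst A, 0\<^sub>m m n) (real_ddiag m n s t)"
    using ex_dunitary_equiv_real_ddiag_if_orbit_normal by fastforce
  then obtain B where B: "dunitary_equiv m n A B" and "fst B = fst (real_ddiag m n s t)"
    by (rule dunitary_equiv_cong_standard_part[OF _ A]) simp
  moreover define S where "S = rect_diag m n (\<lambda>i. complex_of_real (s i))"
  ultimately have B_eq: "B = (S, snd B)" by (simp add: ddiag_def prod_eq_iff)
  have "snd B \<in> carrier_mat m n" using B by (auto simp: dunitary_equiv_def dcarrier_def)
  then obtain B' where B': "orbit_normal S B'" "dunitary_equiv m n (S, snd B) (S, B')"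
    using S_def by (rule ex_orbit_normal_representative)
  then have "(S, B') \<in> dcarrier m n" by (simp add: dunitary_equiv_def)
  then obtain f g where "dunitary_equiv m n (S, B') (real_ddiag m n f g)"
    using ex_dunitary_equiv_real_ddiag_if_orbit_normal B'(1) by fastforce
  then show thesis
    using B B'(2) that by (metis B_eq dunitary_equiv_trans)
qed

lemma dunitary_equiv_ddiag_phase:
  assumes "\<And>i. cmod (h i) = 1"
  shows "dunitary_equiv m n (ddiag m n f g) (ddiag m n (\<lambda>i. h i * f i) (\<lambda>i. h i * g i))"
    (is "dunitary_equiv m n ?A ?B")
proof -
  let ?H = "mat_diag n h"
  have ctrans_H: "ctrans ?H = mat_diag n (\<lambda>i. cnj (h i))"
    by (intro eq_matI) (auto simp: mat_diag_def)
  have unimodular: "cnj (h i) * h i = 1" for i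
    using assms[of i] by (simp add: mult.commute flip: complex_norm_square)
  then have "unitary_mat n ?H" by (intro unitary_matI) (simp_all add: ctrans_H)
  then have "dunitary_equiv m n
      (1\<^sub>m m * fst ?B * ctrans ?H, 1\<^sub>m m * snd ?B * ctrans ?H) ?B"
    by (rule dunitary_equiv_of_unitary_mat[OF unitary_mat_one]) simp
  moreover have unit: "1\<^sub>m m * rect_diag m n (\<lambda>i. h i * x i) * ctrans ?H = rect_diag m n x" for x
  proof -
    have "h i * x i * cnj (h i) = x i" for i
    proof -
      have "h i * x i * cnj (h i) = (cnj (h i) * h i) * x i" by (simp only: mult_ac)
      then show ?thesis by (simp add: unimodular)
    qed
    moreover have "rect_diag m n (\<lambda>i. h i * x i) \<in> carrier_mat m n" by (simp add: rect_diag_def)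
    ultimately show ?thesis
      by (intro eq_matI) (simp_all add: ctrans_H mat_diag_mult_right index_rect_diag)
  qed
  ultimately show ?thesis unfolding ddiag_def fst_conv snd_conv unit by simp
qed

definition perm_mat :: "nat \<Rightarrow> (nat \<Rightarrow> nat) \<Rightarrow> complex mat" where
  "perm_mat n \<pi> = mat n n (\<lambda>(i, j). if i = \<pi> j then 1 else 0)"

lemma dim_perm_mat [simp]: "dim_row (perm_mat n \<pi>) = n" "dim_col (perm_mat n \<pi>) = n"
  by (simp_all add: perm_mat_def)

lemma unitary_mat_perm_mat:
  assumes "\<pi> permutes {..<n}"
  shows "unitary_mat n (perm_mat n \<pi>)"
proof (rule unitary_matI)
  have lt: "\<pi> i < n" if "i < n" for i using permutes_in_image[OF assms, of i] that by simp
  have inj: "\<pi> i = \<pi> j \<longleftrightarrow> i = j" for i j using permutes_inj[OF assms] by (auto dest: injD)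
  show "ctrans (perm_mat n \<pi>) * perm_mat n \<pi> = 1\<^sub>m n"
  proof (rule eq_matI)
    fix i j assume "i < dim_row (1\<^sub>m n :: complex mat)" "j < dim_col (1\<^sub>m n :: complex mat)"
    then have ij: "i < n" "j < n" by simp_all
    have "(ctrans (perm_mat n \<pi>) * perm_mat n \<pi>) $$ (i, j) =
        (\<Sum>k<n. cnj (if k = \<pi> i then 1 else 0) * (if k = \<pi> j then 1 else 0))"
      using ij by (simp add: index_mult_mat_sum perm_mat_def)
    also have "\<dots> = (\<Sum>k<n. if k = \<pi> i then (if \<pi> i = \<pi> j then 1 else 0) else 0)"
      by (intro sum.cong) auto
    also have "\<dots> = 1\<^sub>m n $$ (i, j)" using ij lt by (simp add: inj)
    finally show "(ctrans (perm_mat n \<pi>) * perm_mat n \<pi>) $$ (i, j) = 1\<^sub>m n $$ (i, j)" .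
  qed simp_all
qed (simp add: carrier_matI)

lemma dunitary_equiv_ddiag_permute:
  assumes \<pi>: "\<pi> permutes {..<min m n}"
  shows "dunitary_equiv m n (ddiag m n f g) (ddiag m n (\<lambda>i. f (\<pi> i)) (\<lambda>i. g (\<pi> i)))"
    (is "dunitary_equiv m n ?A ?B")
proof -
  have U: "unitary_mat m (perm_mat m \<pi>)" and V: "unitary_mat n (perm_mat n \<pi>)"
    by (rule unitary_mat_perm_mat[OF permutes_subset[OF \<pi>]]; auto)+
  have lt: "\<pi> i < min m n \<longleftrightarrow> i < min m n" for i using permutes_in_image[OF \<pi>, of i] by simp
  have fixed: "\<pi> i = i" if "\<not> i < min m n" for i using permutes_not_in[OF \<pi>, of i] that by simp
  have "perm_mat m \<pi> * rect_diag m n (\<lambda>i. x (\<pi> i)) = rect_diag m n x * perm_mat n \<pi>" for x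
  proof (rule eq_matI)
    fix i j assume "i < dim_row (rect_diag m n x * perm_mat n \<pi>)"
      "j < dim_col (rect_diag m n x * perm_mat n \<pi>)"
    then have ij: "i < m" "j < n" by simp_all
    show "(perm_mat m \<pi> * rect_diag m n (\<lambda>i. x (\<pi> i))) $$ (i, j) =
        (rect_diag m n x * perm_mat n \<pi>) $$ (i, j)"
      using ij lt[of j] fixed[of j]
      by (cases "j < min m n") (auto simp: index_mult_rect_diag index_rect_diag_mult perm_mat_def)
  qed simp_all
  then have "perm_mat m \<pi> * rect_diag m n (\<lambda>i. x (\<pi> i)) * ctrans (perm_mat n \<pi>) =
      rect_diag m n x" for x
    by (simp add: assoc_mult_mat_dim unitary_matD[OF V])
  then show ?thesis
    using dunitary_equiv_of_unitary_mat[OF U V, of ?B, OF ddiag_dcarrier] by (simp add: ddiag_def)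
qed

lemma ex_descending_permutation:
  fixes key :: "nat \<Rightarrow> 'a::linorder"
  obtains \<pi> where "\<pi> permutes {..<k}" "\<And>i j. i \<le> j \<Longrightarrow> j < k \<Longrightarrow> key (\<pi> j) \<le> key (\<pi> i)"
proof -
  define xs where "xs = rev (sort_key key [0..<k])"
  define \<pi> where "\<pi> i = (if i < k then xs ! i else i)" for i
  have xs: "length xs = k" "distinct xs" "set xs = {..<k}" by (auto simp: xs_def)
  have "bij_betw ((!) xs) {..<k} {..<k}" by (rule bij_betw_nth[OF xs(2)]) (simp_all add: xs)
  then have "bij_betw \<pi> {..<k} {..<k}"
    by (rule bij_betw_cong[THEN iffD1, rotated]) (simp add: \<pi>_def)
  then have "\<pi> permutes {..<k}" by (rule bij_imp_permutes) (simp add: \<pi>_def)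
  moreover have "key (\<pi> j) \<le> key (\<pi> i)" if "i \<le> j" "j < k" for i j
  proof -
    have "sorted (rev (map key xs))" by (simp add: xs_def rev_map)
    then have "map key xs ! j \<le> map key xs ! i"
      using that xs(1) by (metis length_map sorted_rev_nth_mono)
    then show ?thesis using that xs(1) by (simp add: \<pi>_def)
  qed
  ultimately show thesis by (rule that)
qed

lemma ex_dunitary_equiv_sorted_real_ddiag:
  assumes A: "A \<in> dcarrier m n"
  obtains f g where "dunitary_equiv m n A (real_ddiag m n f g)" "\<And>i. (0, 0) \<le> (f i, g i)"
    "\<And>i j. i \<le> j \<Longrightarrow> j < min m n \<Longrightarrow> (f j, g j) \<le> (f i, g i)"
proof -
  obtain f g where equiv: "dunitary_equiv m n A (real_ddiag m n f g)"
    by (rule ex_dunitary_equiv_real_ddiag[OF A])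
  define h :: "nat \<Rightarrow> real" where "h i = (if (f i, g i) < (0, 0) then - 1 else 1)" for i
  define f' where "f' i = h i * f i" for i
  define g' where "g' i = h i * g i" for i
  have nonneg: "(0, 0) \<le> (f' i, g' i)" for i
    by (auto simp: f'_def g'_def h_def less_eq_prod_def less_prod_def)
  obtain \<pi> where \<pi>: "\<pi> permutes {..<min m n}" and descending:
    "\<And>i j. i \<le> j \<Longrightarrow> j < min m n \<Longrightarrow> (f' (\<pi> j), g' (\<pi> j)) \<le> (f' (\<pi> i), g' (\<pi> i))"
    by (rule ex_descending_permutation[of "min m n" "\<lambda>i. (f' i, g' i)"]) blast
  have "dunitary_equiv m n (real_ddiag m n f g) (real_ddiag m n f' g')"
    using dunitary_equiv_ddiag_phase[of "\<lambda>i. complex_of_real (h i)" m n]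
    by (simp add: f'_def g'_def h_def)
  from dunitary_equiv_trans[OF dunitary_equiv_trans[OF equiv this]
      dunitary_equiv_ddiag_permute[OF \<pi>]]
  have "dunitary_equiv m n A (real_ddiag m n (\<lambda>i. f' (\<pi> i)) (\<lambda>i. g' (\<pi> i)))" .
  then show thesis by (rule that[OF _ nonneg descending])
qed

lemma downward_closed_initial_segment:
  fixes k :: nat
  assumes "\<And>i j. i \<le> j \<Longrightarrow> j < k \<Longrightarrow> P j \<Longrightarrow> P i"
  obtains r where "r \<le> k" "\<And>i. i < k \<Longrightarrow> P i \<longleftrightarrow> i < r"
proof
  define r where "r = (LEAST i. k \<le> i \<or> \<not> P i)"
  show "r \<le> k" unfolding r_def by (rule Least_le) simp
  have "k \<le> r \<or> \<not> P r" unfolding r_def by (rule LeastI[of _ k]) simp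
  then show "P i \<longleftrightarrow> i < r" if "i < k" for i
    using assms[of r i] not_less_Least[of i "\<lambda>i. k \<le> i \<or> \<not> P i"] that
    unfolding r_def[symmetric] by (meson leD le_less_trans not_le)
qed

lemma dreal_le_iff: "dreal_le a b \<longleftrightarrow> a \<le> b"
  by (cases a; cases b) (auto simp: dreal_le_def dreal_less_def)

lemma dual_svd_sorted_real_ddiag:
  assumes UV: "dunitary m U" "dunitary n V" and A: "A = U **\<^sub>d real_ddiag m n f g **\<^sub>d dstar V"
    and nonneg: "\<And>i. (0, 0) \<le> (f i, g i)"
    and descending: "\<And>i j. i \<le> j \<Longrightarrow> j < min m n \<Longrightarrow> (f j, g j) \<le> (f i, g i)"
  shows "dual_svd m n A U (real_ddiag m n f g) V"
proof -
  let ?S = "real_ddiag m n f g"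
  have index_S: "fst ?S $$ (i, j) = (if i = j then f i else 0)"
    "snd ?S $$ (i, j) = (if i = j then g i else 0)" if "i < m" "j < n" for i j
    using that by (simp_all add: ddiag_def index_rect_diag)
  obtain r where r: "r \<le> min m n" "\<And>i. i < min m n \<Longrightarrow> f i > 0 \<longleftrightarrow> i < r"
    by (rule downward_closed_initial_segment[of "min m n" "\<lambda>i. f i > 0"])
      (use descending in \<open>force simp: less_eq_prod_def\<close>)+
  obtain t where t: "t \<le> min m n" "\<And>i. i < min m n \<Longrightarrow> (f i, g i) > (0, 0) \<longleftrightarrow> i < t"
    by (rule downward_closed_initial_segment[of "min m n" "\<lambda>i. (f i, g i) > (0, 0)"])
      (use descending less_le_trans in \<open>blast+\<close>)
  have rt: "r \<le> t"
  proof (rule ccontr)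
    assume "\<not> r \<le> t"
    then have "f t > 0" "\<not> (f t, g t) > (0, 0)" using r t(2)[of t] by auto
    then show False by (simp add: less_prod_def)
  qed
  have "f i = 0 \<and> g i > 0" if "r \<le> i" "i < t" for i
  proof -
    have "i < min m n" using that(2) t(1) by simp
    then show ?thesis using r(2)[of i] t(2)[of i] that nonneg[of i] by (auto simp: less_eq_prod_def)
  qed
  moreover have "f i = 0 \<and> g i = 0" if "t \<le> i" "i < min m n" for i
    using t(2)[of i] that nonneg[of i] by (auto simp: less_le)
  ultimately show ?thesis
    unfolding dual_svd_def
    using UV A r rt t(1) descending
    by (intro conjI exI[of _ r] exI[of _ t]) (auto simp: index_S dentry_def dreal_le_iff)
qed

theorem ex_dual_svd:
  assumes "A \<in> dcarrier m n"
  obtains U S V where "dual_svd m n A U S V"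
proof -
  obtain f g where equiv: "dunitary_equiv m n A (real_ddiag m n f g)"
    and sorted: "\<And>i. (0, 0) \<le> (f i, g i)"
      "\<And>i j. i \<le> j \<Longrightarrow> j < min m n \<Longrightarrow> (f j, g j) \<le> (f i, g i)"
    by (rule ex_dunitary_equiv_sorted_real_ddiag[OF assms]) blast
  obtain U V where "dunitary m U" "dunitary n V" "A = U **\<^sub>d real_ddiag m n f g **\<^sub>d dstar V"
    using equiv by (auto simp: dunitary_equiv_def)
  then show thesis by (rule that[OF dual_svd_sorted_real_ddiag[OF _ _ _ sorted]])
qed

section \<open>The dual Moore--Penrose inverse\<close>

lemma is_DMPGI_dstar:
  assumes A: "A \<in> dcarrier m n" and X: "is_DMPGI m n A X"
  shows "is_DMPGI n m (dstar A) (dstar X)"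
proof -
  have dims: "dwf A" "drow A = m" "dcol A = n" "dwf X" "drow X = n" "dcol X = m"
    using A X by (auto simp: is_DMPGI_def dcarrier_iff)
  have star: "dstar A **\<^sub>d dstar X = dstar (X **\<^sub>d A)" "dstar X **\<^sub>d dstar A = dstar (A **\<^sub>d X)"
    "dstar (X **\<^sub>d A) **\<^sub>d dstar A = dstar (A **\<^sub>d (X **\<^sub>d A))"
    "dstar (A **\<^sub>d X) **\<^sub>d dstar X = dstar (X **\<^sub>d (A **\<^sub>d X))"
    by (simp_all add: dstar_dmult dims)
  have "A **\<^sub>d (X **\<^sub>d A) = A" "X **\<^sub>d (A **\<^sub>d X) = X"
    using X by (simp_all add: is_DMPGI_def dmult_assoc dims)
  then show ?thesis
    using X unfolding is_DMPGI_def star by (simp add: dcarrier_iff dims)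
qed

lemma DMPGI_range_projection_unique:
  assumes A: "A \<in> dcarrier m n" and X: "is_DMPGI m n A X" and Y: "is_DMPGI m n A Y"
  shows "A **\<^sub>d X = A **\<^sub>d Y"
proof -
  have dims: "dwf A" "drow A = m" "dcol A = n" "dwf X" "drow X = n" "dcol X = m"
    "dwf Y" "drow Y = n" "dcol Y = m"
    using assms by (auto simp: is_DMPGI_def dcarrier_iff)
  have AXA: "A **\<^sub>d X **\<^sub>d A = A" "dstar (A **\<^sub>d X) = A **\<^sub>d X"
    and AYA: "A **\<^sub>d Y **\<^sub>d A = A" "dstar (A **\<^sub>d Y) = A **\<^sub>d Y"
    using X Y by (simp_all add: is_DMPGI_def)
  have "A **\<^sub>d X = (A **\<^sub>d Y) **\<^sub>d (A **\<^sub>d X)"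
    using arg_cong[OF AYA(1), of "\<lambda>Z. Z **\<^sub>d X"] by (simp add: dmult_assoc dims)
  also have "\<dots> = dstar ((A **\<^sub>d X) **\<^sub>d (A **\<^sub>d Y))"
    by (subst dstar_dmult) (simp_all add: dims AXA(2) AYA(2))
  also have "(A **\<^sub>d X) **\<^sub>d (A **\<^sub>d Y) = A **\<^sub>d Y"
    using arg_cong[OF AXA(1), of "\<lambda>Z. Z **\<^sub>d Y"] by (simp add: dmult_assoc dims)
  finally show ?thesis by (simp add: AYA(2))
qed

lemma is_DMPGI_unique:
  assumes A: "A \<in> dcarrier m n" and X: "is_DMPGI m n A X" and Y: "is_DMPGI m n A Y"
  shows "X = Y"
proof -
  have dims: "dwf A" "drow A = m" "dcol A = n" "dwf X" "drow X = n" "dcol X = m"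
    "dwf Y" "drow Y = n" "dcol Y = m"
    using assms by (auto simp: is_DMPGI_def dcarrier_iff)
  have AX: "A **\<^sub>d X = A **\<^sub>d Y" by (rule DMPGI_range_projection_unique[OF assms])
  have "dstar A \<in> dcarrier n m" by (simp add: dcarrier_iff dims)
  from DMPGI_range_projection_unique[OF this is_DMPGI_dstar[OF A X] is_DMPGI_dstar[OF A Y]]
  have "dstar (X **\<^sub>d A) = dstar (Y **\<^sub>d A)" by (simp add: dstar_dmult dims)
  then have XA: "X **\<^sub>d A = Y **\<^sub>d A" using X Y by (simp add: is_DMPGI_def)
  have "X = X **\<^sub>d A **\<^sub>d X" using X by (simp add: is_DMPGI_def)
  also have "\<dots> = Y **\<^sub>d (A **\<^sub>d X)" unfolding XA by (simp add: dmult_assoc dims)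
  also have "\<dots> = Y" unfolding AX using Y by (simp add: is_DMPGI_def dmult_assoc dims)
  finally show ?thesis .
qed

lemma is_DMPGI_unitary_conj:
  assumes U: "dunitary m U" and V: "dunitary n V" and S: "S \<in> dcarrier m n"
    and Y: "is_DMPGI m n S Y"
  shows "is_DMPGI m n (U **\<^sub>d S **\<^sub>d dstar V) (V **\<^sub>d Y **\<^sub>d dstar U)"
proof -
  have dims: "dwf S" "drow S = m" "dcol S = n" "dwf Y" "drow Y = n" "dcol Y = m"
    using S Y by (auto simp: is_DMPGI_def dcarrier_iff)
  have penrose: "S **\<^sub>d Y **\<^sub>d S = S" "Y **\<^sub>d S **\<^sub>d Y = Y"
    "dstar (S **\<^sub>d Y) = S **\<^sub>d Y" "dstar (Y **\<^sub>d S) = Y **\<^sub>d S"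
    using Y by (simp_all add: is_DMPGI_def)
  note unitary_rules = dunitaryD[OF U] dunitaryD[OF V] dims
  let ?A = "U **\<^sub>d S **\<^sub>d dstar V" and ?X = "V **\<^sub>d Y **\<^sub>d dstar U"
  have AX: "?A **\<^sub>d ?X = U **\<^sub>d (S **\<^sub>d Y) **\<^sub>d dstar U" by (simp add: dmult_assoc unitary_rules)
  have XA: "?X **\<^sub>d ?A = V **\<^sub>d (Y **\<^sub>d S) **\<^sub>d dstar V" by (simp add: dmult_assoc unitary_rules)
  have "?A **\<^sub>d ?X **\<^sub>d ?A = U **\<^sub>d (S **\<^sub>d Y **\<^sub>d S) **\<^sub>d dstar V"
    unfolding AX by (simp add: dmult_assoc unitary_rules)
  moreover have "?X **\<^sub>d ?A **\<^sub>d ?X = V **\<^sub>d (Y **\<^sub>d S **\<^sub>d Y) **\<^sub>d dstar U"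
    unfolding XA by (simp add: dmult_assoc unitary_rules)
  moreover have "dstar (?A **\<^sub>d ?X) = U **\<^sub>d dstar (S **\<^sub>d Y) **\<^sub>d dstar U"
    unfolding AX by (simp add: dmult_assoc dstar_dmult unitary_rules)
  moreover have "dstar (?X **\<^sub>d ?A) = V **\<^sub>d dstar (Y **\<^sub>d S) **\<^sub>d dstar V"
    unfolding XA by (simp add: dmult_assoc dstar_dmult unitary_rules)
  ultimately show ?thesis
    unfolding is_DMPGI_def penrose AX[symmetric] XA[symmetric]
    by (simp add: dcarrier_iff unitary_rules)
qed

lemma ex_DMPGI_cong_dunitary_equiv:
  assumes "dunitary_equiv m n A B"
  shows "(\<exists>X. is_DMPGI m n A X) \<longleftrightarrow> (\<exists>Y. is_DMPGI m n B Y)"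
proof -
  have "\<exists>X. is_DMPGI m n C X" if "dunitary_equiv m n C D" "is_DMPGI m n D Y" for C D Y
    using that is_DMPGI_unitary_conj unfolding dunitary_equiv_def by blast
  then show ?thesis using assms dunitary_equiv_sym by blast
qed

text \<open>Where \<open>f i = 0\<close>, the entries of the inverse are \<open>0\<close> because \<open>inverse 0 = 0\<close>.\<close>
lemma is_DMPGI_ddiag:
  assumes "\<And>i. i < min m n \<Longrightarrow> f i = 0 \<Longrightarrow> g i = 0"
  shows "is_DMPGI m n (ddiag m n f g)
    (ddiag n m (\<lambda>i. inverse (f i)) (\<lambda>i. - inverse (f i * f i) * g i))"
    (is "is_DMPGI m n ?S ?Y")
proof -
  let ?e = "\<lambda>i. if i < min m n \<and> f i \<noteq> 0 then 1 else 0 :: complex"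
  have SY: "?S **\<^sub>d ?Y = ddiag m m ?e (\<lambda>_. 0)"
    by (auto simp: ddiag_def dmult_def rect_diag_mult_rect_diag rect_diag_add_rect_diag
        field_simps intro!: rect_diag_cong)
  have YS: "?Y **\<^sub>d ?S = ddiag n n ?e (\<lambda>_. 0)"
    by (auto simp: ddiag_def dmult_def rect_diag_mult_rect_diag rect_diag_add_rect_diag
        field_simps intro!: rect_diag_cong)
  have "?S **\<^sub>d ?Y **\<^sub>d ?S = ?S"
    unfolding SY using assms
    by (auto simp: ddiag_def dmult_def rect_diag_mult_rect_diag rect_diag_add_rect_diag
        intro!: rect_diag_cong)
  moreover have "?Y **\<^sub>d ?S **\<^sub>d ?Y = ?Y"
    unfolding YS
    by (auto simp: ddiag_def dmult_def rect_diag_mult_rect_diag rect_diag_add_rect_diag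
        intro!: rect_diag_cong)
  moreover have "dstar (?S **\<^sub>d ?Y) = ?S **\<^sub>d ?Y" "dstar (?Y **\<^sub>d ?S) = ?Y **\<^sub>d ?S"
    unfolding SY YS by (auto simp: ddiag_def dstar_def ctrans_rect_diag intro!: rect_diag_cong)
  ultimately show ?thesis unfolding is_DMPGI_def by simp
qed

lemma ddiag_infinitesimal_eq_0_if_DMPGI:
  assumes Y: "is_DMPGI m n (ddiag m n f g) Y" and i: "i < min m n" and f: "f i = 0"
  shows "g i = 0"
proof -
  have "Y \<in> dcarrier n m" and eq: "ddiag m n f g **\<^sub>d Y **\<^sub>d ddiag m n f g = ddiag m n f g"
    using Y by (simp_all add: is_DMPGI_def)
  note dims = dcarrierD[OF this(1)]
  have "g i = snd (ddiag m n f g **\<^sub>d Y **\<^sub>d ddiag m n f g) $$ (i, i)"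
    unfolding eq using i by (simp add: ddiag_def index_rect_diag)
  also have "\<dots> = 0"
    using i f dims by (simp add: ddiag_def dmult_def index_mult_rect_diag index_rect_diag_mult
        assoc_mult_mat_dim add_mult_distrib_mat_dim)
  finally show ?thesis .
qed

lemma ex_DMPGI_ddiag_iff:
  "(\<exists>Y. is_DMPGI m n (ddiag m n f g) Y) \<longleftrightarrow> (\<forall>i<min m n. f i = 0 \<longrightarrow> g i = 0)"
  using is_DMPGI_ddiag ddiag_infinitesimal_eq_0_if_DMPGI by blast

lemma dual_svd_eq_ddiag:
  assumes "dual_svd m n A U S V"
  shows "S = ddiag m n (\<lambda>i. fst S $$ (i, i)) (\<lambda>i. snd S $$ (i, i))"
proof -
  have "S \<in> dcarrier m n" and "\<forall>i<m. \<forall>j<n. i \<noteq> j \<longrightarrow> dentry S i j = (0, 0)"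
    using assms by (auto simp: dual_svd_def)
  then show ?thesis
    by (auto simp: prod_eq_iff ddiag_def index_rect_diag dentry_def dcarrierD intro!: eq_matI)
qed

lemma dual_svd_dunitary_equiv:
  assumes "dual_svd m n A U S V"
  shows "dunitary_equiv m n A S"
  using assms unfolding dual_svd_def by (blast intro: dunitary_equivI)

lemma ex_DMPGI_iff_appreciable:
  assumes svd: "dual_svd m n A U S V"
  shows "(\<exists>X. is_DMPGI m n A X) \<longleftrightarrow>
    (\<forall>i<min m n. dentry S i i \<noteq> (0, 0) \<longrightarrow> appreciable (dentry S i i))"
proof -
  have "(\<exists>X. is_DMPGI m n A X) \<longleftrightarrow> (\<exists>Y. is_DMPGI m n S Y)"
    by (rule ex_DMPGI_cong_dunitary_equiv[OF dual_svd_dunitary_equiv[OF svd]])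
  also have "\<dots> \<longleftrightarrow> (\<forall>i<min m n. fst S $$ (i, i) = 0 \<longrightarrow> snd S $$ (i, i) = 0)"
    using ex_DMPGI_ddiag_iff[of m n "\<lambda>i. fst S $$ (i, i)" "\<lambda>i. snd S $$ (i, i)"]
    unfolding dual_svd_eq_ddiag[OF svd, symmetric] .
  also have "\<dots> \<longleftrightarrow> (\<forall>i<min m n. dentry S i i \<noteq> (0, 0) \<longrightarrow> appreciable (dentry S i i))"
    by (auto simp: dentry_def appreciable_def)
  finally show ?thesis .
qed

lemma sigma_r_pinv_eq_ddiag:
  assumes "\<forall>i. r \<le> i \<and> i < min m n \<longrightarrow> dentry S i i = (0, 0)"
  shows "sigma_r_pinv m n r S = ddiag n m (\<lambda>i. inverse (fst S $$ (i, i)))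
    (\<lambda>i. - inverse (fst S $$ (i, i) * fst S $$ (i, i)) * snd S $$ (i, i))"
  using assms by (auto simp: sigma_r_pinv_def ddiag_def rect_diag_def dentry_def intro!: eq_matI)

lemma is_DMPGI_of_dual_svd:
  assumes svd: "dual_svd m n A U S V"
    and appreciable: "\<forall>i<r. appreciable (dentry S i i)"
    and zero: "\<forall>i. r \<le> i \<and> i < min m n \<longrightarrow> dentry S i i = (0, 0)"
  shows "is_DMPGI m n A (V **\<^sub>d sigma_r_pinv m n r S **\<^sub>d dstar U)"
proof -
  have UV: "dunitary m U" "dunitary n V" "S \<in> dcarrier m n" and A: "A = U **\<^sub>d S **\<^sub>d dstar V"
    using svd by (auto simp: dual_svd_def)
  have "snd S $$ (i, i) = 0" if "i < min m n" "fst S $$ (i, i) = 0" for i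
    using that appreciable zero by (cases "i < r") (auto simp: appreciable_def dentry_def)
  from is_DMPGI_ddiag[of m n "\<lambda>i. fst S $$ (i, i)" "\<lambda>i. snd S $$ (i, i)", OF this]
  have "is_DMPGI m n S (sigma_r_pinv m n r S)"
    unfolding sigma_r_pinv_eq_ddiag[OF zero] dual_svd_eq_ddiag[OF svd, symmetric] .
  then show ?thesis unfolding A by (rule is_DMPGI_unitary_conj[OF UV])
qed

theorem theorem5p1:
  fixes m n :: nat and A :: dcmat
  assumes "A \<in> dcarrier m n"
  shows "((\<exists>X. is_DMPGI m n A X) \<longleftrightarrow>
          (\<forall>U S V. dual_svd m n A U S V \<longrightarrow>
              (\<forall>i<min m n. dentry S i i \<noteq> (0,0) \<longrightarrow> appreciable (dentry S i i))))
       \<and> ((\<exists>X. is_DMPGI m n A X) \<longrightarrow>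
          (\<forall>U S V r. dual_svd m n A U S V \<and> r \<le> min m n \<and>
              (\<forall>i<r. appreciable (dentry S i i)) \<and>
              (\<forall>i. r \<le> i \<and> i < min m n \<longrightarrow> dentry S i i = (0,0)) \<longrightarrow>
              is_DMPGI m n A (V **\<^sub>d sigma_r_pinv m n r S **\<^sub>d dstar U) \<and>
              (\<forall>X. is_DMPGI m n A X \<longrightarrow> X = V **\<^sub>d sigma_r_pinv m n r S **\<^sub>d dstar U)))"
proof (rule conjI)
  obtain U S V where "dual_svd m n A U S V" by (rule ex_dual_svd[OF assms])
  then show "(\<exists>X. is_DMPGI m n A X) \<longleftrightarrow>
      (\<forall>U S V. dual_svd m n A U S V \<longrightarrow>
        (\<forall>i<min m n. dentry S i i \<noteq> (0,0) \<longrightarrow> appreciable (dentry S i i)))"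
    using ex_DMPGI_iff_appreciable by metis
qed (use is_DMPGI_of_dual_svd is_DMPGI_unique[OF assms] in blast)

end
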